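(* Let $\mathbf P=G_{m,n}$ be a 2D-grid with $m,n\ge 2$, let $M\in\operatorname{mod}\Bbbk[\mathbf P]$, and let $I$ be an interval of $\mathbf P$. Write $\mathrm{sc}(I)=\{a_1,\dots,a_k\}$ and $\mathrm{sk}(I)=\{b_1,\dots,b_l\}$, each indexed so that the second coordinates strictly increase with the index. Put $a_{i,i+1}=a_i\vee a_{i+1}$ $(1\le i\le k-1)$, $b_{i,i+1}=b_i\wedge b_{i+1}$ $(1\le i\le l-1)$ (join and meet in the grid), $\mathrm{sc}_1^\circ(I)=\{a_{i,i+1}\mid 1\le i\le k-1\}$ and $\mathrm{sk}_1^\circ(I)=\{b_{i,i+1}\mid 1\le i\le l-1\}$. Fix choice maps $\mathbf c\colon\mathrm{sc}({\Uparrow}I)\to\mathrm{sc}(I)$, $\mathbf d\colon\mathrm{sk}({\Downarrow}I)\to\mathrm{sk}(I)$ and a pair $(b_j,a_i)\in\mathrm{sk}(I)\times\mathrm{sc}(I)$ with $b_j\ge a_i$. Then $$d_M(V_I)=\operatorname{rank}\begin{bmatrix}\mathsf M_1&\mathbf 0&\mathbf 0\\ \mathsf M_2&\mathbf 0&\mathbf 0\\ \mathsf M_3&\mathsf M_4&\mathsf M_5\end{bmatrix}-\operatorname{rank}\begin{bmatrix}\mathsf M_1&\mathbf 0&\mathbf 0\\ \mathsf M_2&\mathbf 0&\mathbf 0\\ \mathbf 0&\mathsf M_4&\mathsf M_5\end{bmatrix},$$ where block rows are indexed by $\mathrm{sc}_1^\circ(I),\mathrm{sc}({\Uparrow}I),\mathrm{sk}(I)$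 and block columns by $\mathrm{sc}(I),\mathrm{sk}({\Downarrow}I),\mathrm{sk}_1^\circ(I)$. Here $$\mathsf M_1=\begin{bmatrix}M_{a_{12},a_1}&-M_{a_{12},a_2}\\&M_{a_{23},a_2}&-M_{a_{23},a_3}\\&&\ddots&\ddots\\&&&M_{a_{k-1,k},a_{k-1}}&-M_{a_{k-1,k},a_k}\end{bmatrix},$$ $$\mathsf M_5=\begin{bmatrix}M_{b_1,b_{12}}\\-M_{b_2,b_{12}}&M_{b_2,b_{23}}\\&-M_{b_3,b_{23}}&\ddots\\&&\ddots&M_{b_{l-1},b_{l-1,l}}\\&&&-M_{b_l,b_{l-1,l}}\end{bmatrix}$$ (blank entries are zero), $$\mathsf M_2=\big[\delta_{a,\mathbf c(a')}M_{a',\mathbf c(a')}\big]_{(a',a)\in\mathrm{sc}({\Uparrow}I)\times\mathrm{sc}(I)},\qquad\mathsf M_4=\big[\delta_{b,\mathbf d(b')}M_{\mathbf d(b'),b'}\big]_{(b,b')\in\mathrm{sk}(I)\times\mathrm{sk}({\Downarrow}I)},$$ and $\mathsf M_3$ (indexed by $\mathrm{sk}(I)\times\mathrm{sc}(I)$) has $(b_j,a_i)$-entry $M_{b_j,a_i}$ and all other entries zero. Index sets may be empty, in which case the corresponding block rows or columns are removed.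
   Context: $\Bbbk$ is a field. $G_{m,n}=\{1,\dots,m\}\times\{1,\dots,n\}$ with the product order $(x,y)\le(x',y')\iff x\le x'$ and $y\le y'$. A finite poset $\mathbf P$ is regarded as a category with exactly one morphism $p_{y,x}\colon x\to y$ when $x\le y$; $\operatorname{mod}\Bbbk[\mathbf P]$ is the category of functors $M\colon\mathbf P\to\operatorname{mod}\Bbbk$ to finite-dimensional $\Bbbk$-vector spaces (equivalently $\Bbbk$-linear functors on the linearization $\Bbbk[\mathbf P]$). For $x\le y$ write $M_{y,x}:=M(p_{y,x})\colon M(x)\to M(y)$. An interval of $\mathbf P$ is a nonempty full subposet $I$ that is connected (any two elements are joined by a sequence of consecutively comparable elements of $I$) and convex ($x\le z\le y$ with $x,y\in I$ implies $z\in I$). The interval module $V_I$ has $V_I(x)=\Bbbk$ for $x\in I$, $0$ otherwise, with $V_I(p_{y,x})=\mathrm{id}_\Bbbk$ for $x\le y$ in $I$ and all other structure maps $0$. It is indecomposable, and $d_M(V_I)$ is its multiplicity in a decomposition of $M$ into indecomposables. For $U\subseteq\mathbf P$, $\mathrm{sc}(U)$ and $\mathrm{sk}(U)$ are the sets of minimal and maximal elements of $U$. ${\uparrow}I=\{y\in\mathbf P\mid y\ge x\text{ for some }x\in I\}$, ${\downarrow}I=\{y\in\mathbf P\mid y\le x\text{ for some }x\in I\}$, ${\Uparrow}I={\uparrow}I\setminus I$, ${\Downarrow}I={\downarrow}I\setminus I$. A choice map $\mathbf c\colon\mathrm{sc}({\Uparrow}I)\to\mathrm{sc}(I)$ is any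 map with $\mathbf c(a')\le a'$ for all $a'$; a choice map $\mathbf d\colon\mathrm{sk}({\Downarrow}I)\to\mathrm{sk}(I)$ is any map with $\mathbf d(b')\ge b'$ for all $b'$. $\delta$ is the Kronecker delta. The matrices are block matrices of linear maps: a column index $x$ stands for the source summand $M(x)$ and a row index $y$ for the target summand $M(y)$. *)

theory Defs
  imports Complex_Main "HOL-Library.Product_Order" "HOL-Library.Function_Algebras"
begin

section \<open>Finite posets\<close>

text \<open>A finite poset is a finite subset \<open>P\<close> of an ordered type.  The order on
  pairs is the product order, so \<open>sup\<close> and \<open>inf\<close> on \<open>nat \<times> nat\<close> are the join and
  meet of the grid.\<close>

definition grid :: "nat \<Rightarrow> nat \<Rightarrow> (nat \<times> nat) set" where
  "grid m n = {1..m} \<times> {1..n}"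

definition poset_connected :: "'p::order set \<Rightarrow> bool" where
  "poset_connected I \<longleftrightarrow>
     (\<forall>x\<in>I. \<forall>y\<in>I. (x, y) \<in> {(u, v). u \<in> I \<and> v \<in> I \<and> (u \<le> v \<or> v \<le> u)}\<^sup>*)"

definition poset_convex :: "'p::order set \<Rightarrow> 'p set \<Rightarrow> bool" where
  "poset_convex P I \<longleftrightarrow> (\<forall>x\<in>I. \<forall>y\<in>I. \<forall>z\<in>P. x \<le> z \<and> z \<le> y \<longrightarrow> z \<in> I)"

definition poset_interval :: "'p::order set \<Rightarrow> 'p set \<Rightarrow> bool" where
  "poset_interval P I \<longleftrightarrow> I \<subseteq> P \<and> I \<noteq> {} \<and> poset_connected I \<and> poset_convex P I"

text \<open>\<open>sc U\<close> and \<open>sk U\<close> (source and sink) are the minimal and maximal elements.\<close>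

definition sc :: "'p::order set \<Rightarrow> 'p set" where
  "sc U = {x \<in> U. \<forall>y\<in>U. y \<le> x \<longrightarrow> y = x}"

definition sk :: "'p::order set \<Rightarrow> 'p set" where
  "sk U = {x \<in> U. \<forall>y\<in>U. x \<le> y \<longrightarrow> y = x}"

definition up_set :: "'p::order set \<Rightarrow> 'p set \<Rightarrow> 'p set" where
  "up_set P I = {y \<in> P. \<exists>x\<in>I. x \<le> y}"

definition down_set :: "'p::order set \<Rightarrow> 'p set \<Rightarrow> 'p set" where
  "down_set P I = {y \<in> P. \<exists>x\<in>I. y \<le> x}"

definition strict_up_set :: "'p::order set \<Rightarrow> 'p set \<Rightarrow> 'p set" where
  "strict_up_set P I = up_set P I - I"

definition strict_down_set :: "'p::order set \<Rightarrow> 'p set \<Rightarrow> 'p set" where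
  "strict_down_set P I = down_set P I - I"

text \<open>Choice maps are total functions of which only the values on
  \<open>sc (strict_up_set P I)\<close>, resp. \<open>sk (strict_down_set P I)\<close>, are ever used.\<close>

definition up_choice :: "'p::order set \<Rightarrow> 'p set \<Rightarrow> ('p \<Rightarrow> 'p) \<Rightarrow> bool" where
  "up_choice P I c \<longleftrightarrow> (\<forall>a'\<in>sc (strict_up_set P I). c a' \<in> sc I \<and> c a' \<le> a')"

definition down_choice :: "'p::order set \<Rightarrow> 'p set \<Rightarrow> ('p \<Rightarrow> 'p) \<Rightarrow> bool" where
  "down_choice P I d \<longleftrightarrow> (\<forall>b'\<in>sk (strict_down_set P I). d b' \<in> sk I \<and> b' \<le> d b')"


section \<open>Finite-dimensional modules over a poset\<close>

text \<open>The spaces of a functor are subspaces of one ambient vector space with scalar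
  multiplication \<open>s\<close>; no dimension bound is imposed on the ambient space.
  \<open>struct_map M y x\<close> is the structure map from \<open>vspace M x\<close> to \<open>vspace M y\<close>, relevant only
  for \<open>x \<le> y\<close> in \<open>P\<close> and on vectors of \<open>vspace M x\<close>.\<close>

record ('p, 'v) pmodule =
  vspace :: "'p \<Rightarrow> 'v set"
  struct_map :: "'p \<Rightarrow> 'p \<Rightarrow> 'v \<Rightarrow> 'v"

definition linear_map_on ::
    "('k::field \<Rightarrow> 'v::ab_group_add \<Rightarrow> 'v) \<Rightarrow> ('k \<Rightarrow> 'w::ab_group_add \<Rightarrow> 'w)
     \<Rightarrow> 'v set \<Rightarrow> 'w set \<Rightarrow> ('v \<Rightarrow> 'w) \<Rightarrow> bool" where
  "linear_map_on s t V W h \<longleftrightarrow>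
     (\<forall>v\<in>V. h v \<in> W) \<and>
     (\<forall>u\<in>V. \<forall>v\<in>V. h (u + v) = h u + h v) \<and>
     (\<forall>r. \<forall>v\<in>V. h (s r v) = t r (h v))"

definition is_pmodule ::
    "('k::field \<Rightarrow> 'v::ab_group_add \<Rightarrow> 'v) \<Rightarrow> 'p::order set \<Rightarrow> ('p, 'v) pmodule \<Rightarrow> bool" where
  "is_pmodule s P M \<longleftrightarrow>
     vector_space s \<and>
     (\<forall>x\<in>P. module.subspace s (vspace M x) \<and>
              (\<exists>B. finite B \<and> vspace M x = module.span s B)) \<and>
     (\<forall>x\<in>P. \<forall>y\<in>P. x \<le> y \<longrightarrow> linear_map_on s s (vspace M x) (vspace M y) (struct_map M y x)) \<and>
     (\<forall>x\<in>P. \<forall>v\<in>vspace M x. struct_map M x x v = v) \<and>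
     (\<forall>x\<in>P. \<forall>y\<in>P. \<forall>z\<in>P. x \<le> y \<and> y \<le> z \<longrightarrow>
        (\<forall>v\<in>vspace M x. struct_map M z x v = struct_map M z y (struct_map M y x v)))"

definition pmodule_iso ::
    "('k::field \<Rightarrow> 'v::ab_group_add \<Rightarrow> 'v) \<Rightarrow> ('k \<Rightarrow> 'w::ab_group_add \<Rightarrow> 'w)
     \<Rightarrow> 'p::order set \<Rightarrow> ('p, 'v) pmodule \<Rightarrow> ('p, 'w) pmodule \<Rightarrow> bool" where
  "pmodule_iso s t P M N \<longleftrightarrow>
     (\<exists>h. (\<forall>x\<in>P. linear_map_on s t (vspace M x) (vspace N x) (h x) \<and>
                   bij_betw (h x) (vspace M x) (vspace N x)) \<and>
          (\<forall>x\<in>P. \<forall>y\<in>P. x \<le> y \<longrightarrow>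
             (\<forall>v\<in>vspace M x. h y (struct_map M y x v) = struct_map N y x (h x v))))"

text \<open>A submodule of \<open>M\<close> is given by its family \<open>U\<close> of spaces; as a module in its
  own right it is \<open>M\<lparr>vspace := U\<rparr>\<close>.\<close>

definition is_submodule ::
    "('k::field \<Rightarrow> 'v::ab_group_add \<Rightarrow> 'v) \<Rightarrow> 'p::order set \<Rightarrow> ('p, 'v) pmodule
     \<Rightarrow> ('p \<Rightarrow> 'v set) \<Rightarrow> bool" where
  "is_submodule s P M U \<longleftrightarrow>
     (\<forall>x\<in>P. module.subspace s (U x) \<and> U x \<subseteq> vspace M x) \<and>
     (\<forall>x\<in>P. \<forall>y\<in>P. x \<le> y \<longrightarrow> (\<forall>v\<in>U x. struct_map M y x v \<in> U y))"

text \<open>\<open>M\<close> is the internal direct sum of the submodules \<open>U 0, \<dots>, U (r - 1)\<close>.\<close>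

definition is_direct_sum ::
    "('k::field \<Rightarrow> 'v::ab_group_add \<Rightarrow> 'v) \<Rightarrow> 'p::order set \<Rightarrow> ('p, 'v) pmodule
     \<Rightarrow> nat \<Rightarrow> (nat \<Rightarrow> 'p \<Rightarrow> 'v set) \<Rightarrow> bool" where
  "is_direct_sum s P M r U \<longleftrightarrow>
     (\<forall>i<r. is_submodule s P M (U i)) \<and>
     (\<forall>x\<in>P. \<forall>v\<in>vspace M x.
        \<exists>!u. (\<forall>i<r. u i \<in> U i x) \<and> (\<forall>i\<ge>r. u i = 0) \<and> v = (\<Sum>i<r. u i))"

definition indecomposable ::
    "('k::field \<Rightarrow> 'v::ab_group_add \<Rightarrow> 'v) \<Rightarrow> 'p::order set \<Rightarrow> ('p, 'v) pmodule \<Rightarrow> bool" where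
  "indecomposable s P M \<longleftrightarrow>
     (\<exists>x\<in>P. vspace M x \<noteq> {0}) \<and>
     (\<forall>U. is_direct_sum s P M 2 U \<longrightarrow>
        (\<forall>x\<in>P. U 0 x = {0}) \<or> (\<forall>x\<in>P. U 1 x = {0}))"

text \<open>The number of summands isomorphic to \<open>L\<close> in a decomposition of \<open>M\<close> into
  indecomposables; such a decomposition exists and the number does not depend on it
  (Krull--Schmidt).\<close>

definition multiplicity_in ::
    "('k::field \<Rightarrow> 'v::ab_group_add \<Rightarrow> 'v) \<Rightarrow> ('k \<Rightarrow> 'w::ab_group_add \<Rightarrow> 'w)
     \<Rightarrow> 'p::order set \<Rightarrow> ('p, 'v) pmodule \<Rightarrow> ('p, 'w) pmodule \<Rightarrow> nat" where
  "multiplicity_in s t P M L =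
     (THE d. \<exists>r U. is_direct_sum s P M r U \<and>
        (\<forall>i<r. indecomposable s P (M\<lparr>vspace := U i\<rparr>)) \<and>
        d = card {i. i < r \<and> pmodule_iso s t P (M\<lparr>vspace := U i\<rparr>) L})"

text \<open>The interval module, over the field viewed as a vector space over itself by
  \<open>(*)\<close>.\<close>

definition interval_module :: "'p::order set \<Rightarrow> ('p, 'k::field) pmodule" where
  "interval_module I =
     \<lparr>vspace = (\<lambda>x. if x \<in> I then UNIV else {0}),
      struct_map = (\<lambda>y x v. if x \<in> I \<and> y \<in> I \<and> x \<le> y then v else 0)\<rparr>"


section \<open>Block matrices of linear maps\<close>

text \<open>The entry \<open>A r c\<close> of a block matrix is the map from the summand of column \<open>c\<close> to
  the summand of row \<open>r\<close>.  Blocks are put side by side and on top of each other by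
  disjoint sums of index types, since the same grid point may occur as an index in
  different blocks (a minimum of an interval may be a meet of two of its maxima).\<close>

type_synonym ('r, 'c, 'v) block_matrix = "'r \<Rightarrow> 'c \<Rightarrow> 'v \<Rightarrow> 'v"

definition zero_block :: "('r, 'c, 'v::zero) block_matrix" where
  "zero_block = (\<lambda>r c v. 0)"

definition block_row :: "('r, 'c1, 'v) block_matrix \<Rightarrow> ('r, 'c2, 'v) block_matrix
    \<Rightarrow> ('r, 'c3, 'v) block_matrix \<Rightarrow> ('r, 'c1 + 'c2 + 'c3, 'v) block_matrix" where
  "block_row A B C = (\<lambda>r. case_sum (A r) (case_sum (B r) (C r)))"

definition block_column :: "('r1, 'c, 'v) block_matrix \<Rightarrow> ('r2, 'c, 'v) block_matrix
    \<Rightarrow> ('r3, 'c, 'v) block_matrix \<Rightarrow> ('r1 + 'r2 + 'r3, 'c, 'v) block_matrix" where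
  "block_column A B C = case_sum A (case_sum B C)"

definition direct_sum_space :: "'c set \<Rightarrow> ('c \<Rightarrow> 'v::zero set) \<Rightarrow> ('c \<Rightarrow> 'v) set" where
  "direct_sum_space C S = {f. (\<forall>c\<in>C. f c \<in> S c) \<and> (\<forall>c. c \<notin> C \<longrightarrow> f c = 0)}"

definition block_apply :: "'r set \<Rightarrow> 'c set \<Rightarrow> ('r, 'c, 'v::ab_group_add) block_matrix
    \<Rightarrow> ('c \<Rightarrow> 'v) \<Rightarrow> ('r \<Rightarrow> 'v)" where
  "block_apply R C A f = (\<lambda>r. if r \<in> R then (\<Sum>c\<in>C. A r c (f c)) else 0)"

text \<open>The rank is the dimension of the image of the linear map between direct sums;
  \<open>S c\<close> is the source summand of column \<open>c\<close>.\<close>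

definition block_rank :: "('k::field \<Rightarrow> 'v::ab_group_add \<Rightarrow> 'v) \<Rightarrow> 'r set \<Rightarrow> 'c set
    \<Rightarrow> ('c \<Rightarrow> 'v set) \<Rightarrow> ('r, 'c, 'v) block_matrix \<Rightarrow> nat" where
  "block_rank s R C S A =
     vector_space.dim (\<lambda>r f i. s r (f i)) (block_apply R C A ` direct_sum_space C S)"


section \<open>The blocks of the rank formula\<close>

text \<open>\<open>a 1, \<dots>, a k\<close> and \<open>b 1, \<dots>, b l\<close> enumerate \<open>sc I\<close> and \<open>sk I\<close>.  All blocks
  are indexed by grid points.\<close>

definition sc1 :: "nat \<Rightarrow> (nat \<Rightarrow> 'p::lattice) \<Rightarrow> 'p set" where
  "sc1 k a = {sup (a i) (a (i + 1)) |i. 1 \<le> i \<and> i + 1 \<le> k}"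

definition sk1 :: "nat \<Rightarrow> (nat \<Rightarrow> 'p::lattice) \<Rightarrow> 'p set" where
  "sk1 l b = {inf (b i) (b (i + 1)) |i. 1 \<le> i \<and> i + 1 \<le> l}"

definition block1 :: "('p::lattice, 'v::ab_group_add) pmodule \<Rightarrow> nat \<Rightarrow> (nat \<Rightarrow> 'p)
    \<Rightarrow> ('p, 'p, 'v) block_matrix" where
  "block1 M k a = (\<lambda>y x v.
     if \<exists>i. 1 \<le> i \<and> i + 1 \<le> k \<and> y = sup (a i) (a (i + 1)) \<and> x = a i
     then struct_map M y x v
     else if \<exists>i. 1 \<le> i \<and> i + 1 \<le> k \<and> y = sup (a i) (a (i + 1)) \<and> x = a (i + 1)
     then - struct_map M y x v
     else 0)"

definition block2 :: "('p, 'v::ab_group_add) pmodule \<Rightarrow> ('p \<Rightarrow> 'p)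
    \<Rightarrow> ('p, 'p, 'v) block_matrix" where
  "block2 M c = (\<lambda>a' a v. if a = c a' then struct_map M a' a v else 0)"

definition block3 :: "('p, 'v::ab_group_add) pmodule \<Rightarrow> 'p \<Rightarrow> 'p
    \<Rightarrow> ('p, 'p, 'v) block_matrix" where
  "block3 M b0 a0 = (\<lambda>b a v. if b = b0 \<and> a = a0 then struct_map M b a v else 0)"

definition block4 :: "('p, 'v::ab_group_add) pmodule \<Rightarrow> ('p \<Rightarrow> 'p)
    \<Rightarrow> ('p, 'p, 'v) block_matrix" where
  "block4 M d = (\<lambda>b b' v. if b = d b' then struct_map M b b' v else 0)"

definition block5 :: "('p::lattice, 'v::ab_group_add) pmodule \<Rightarrow> nat \<Rightarrow> (nat \<Rightarrow> 'p)
    \<Rightarrow> ('p, 'p, 'v) block_matrix" where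
  "block5 M l b = (\<lambda>y x v.
     if \<exists>i. 1 \<le> i \<and> i + 1 \<le> l \<and> x = inf (b i) (b (i + 1)) \<and> y = b i
     then struct_map M y x v
     else if \<exists>i. 1 \<le> i \<and> i + 1 \<le> l \<and> x = inf (b i) (b (i + 1)) \<and> y = b (i + 1)
     then - struct_map M y x v
     else 0)"

end

theory Submission
  imports Defs
begin

text \<open>For a block matrix with diagonal blocks \<open>X\<close> (the blocks \<open>M1\<close>, \<open>M2\<close>) and \<open>Y\<close> (the blocks
  \<open>M4\<close>, \<open>M5\<close>) and corner \<open>C = M3\<close>, the difference of the two ranks is the rank of the map
  \<open>ker X \<rightarrow> coker Y\<close> induced by \<open>C\<close>.  Reading the minimal elements of \<open>I\<close> as generators and the
  rows of \<open>X\<close> as relations of \<open>V\<^sub>I\<close>, and dually for \<open>Y\<close>, one finds \<open>ker X = Hom(V\<^sub>I, M)\<close> and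
  \<open>coker Y = Hom(M, V\<^sub>I)\<^sup>*\<close>, and \<open>C\<close> becomes the composition pairing
  \<open>Hom(M, V\<^sub>I) \<times> Hom(V\<^sub>I, M) \<rightarrow> End(V\<^sub>I) = k\<close>.  In a decomposition of \<open>M\<close> into indecomposables a
  summand contributes rank 1 to this pairing if it is isomorphic to \<open>V\<^sub>I\<close> and 0 otherwise, because a
  nonzero composite \<open>V\<^sub>I \<rightarrow> L \<rightarrow> V\<^sub>I\<close> splits \<open>V\<^sub>I\<close> off \<open>L\<close>.  In particular the number of summands
  isomorphic to \<open>V\<^sub>I\<close> is the same for all decompositions, without an appeal to Krull--Schmidt.\<close>

section \<open>Dimensions of finitely spanned subspaces\<close>

text \<open>The cokernel is never formed. A vector in row \<open>b j\<close> lies in the image of Y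
  as soon as every morphism from M to V_I annihilates it: a functional separating it from that
  image, restricted to the rows in \<open>sk I\<close>, would itself extend to such a morphism. The
  shape of the grid enters through antichains: when they are listed by second coordinate, the
  members below (or above) a given point form a consecutive run, so joins or meets of neighbours
  already supply all relations. This is why \<open>M1\<close> and \<open>M5\<close> are bidiagonal.
  A single nonzero entry in \<open>M3\<close> suffices because a composite V_I -> M -> V_I is the
  same scalar at every point of the connected set I and can be read off at \<open>b j\<close>. The
  ambient space may be infinite dimensional, and \<open>dim\<close> is 0 for a subspace without
  finite basis; dimension counts are therefore confined to subsets of the span of a finite
  set.\<close>

definition finitely_spanned ::
    "('k::field \<Rightarrow> 'v::ab_group_add \<Rightarrow> 'v) \<Rightarrow> 'v set \<Rightarrow> bool" where
  "finitely_spanned s V \<longleftrightarrow> (\<exists>B. finite B \<and> V \<subseteq> module.span s B)"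

context
  fixes s :: "'k::field \<Rightarrow> 'v::ab_group_add \<Rightarrow> 'v"
  assumes vector_space: "vector_space s"
begin

interpretation V: vector_space s by (rule vector_space)

lemma finitely_spanned_subset:
  "finitely_spanned s W \<Longrightarrow> V \<subseteq> W \<Longrightarrow> finitely_spanned s V"
  unfolding finitely_spanned_def by blast

lemma finite_independent_subset:
  assumes "finitely_spanned s V" "V.independent B" "B \<subseteq> V"
  shows "finite B"
  using assms V.independent_span_bound unfolding finitely_spanned_def by blast

lemma dim_subset_finitely_spanned:
  assumes "finitely_spanned s W" "V \<subseteq> W"
  shows "V.dim V \<le> V.dim W"
proof -
  obtain B where B: "B \<subseteq> V" "V.independent B" "V \<subseteq> V.span B" "card B = V.dim V"
    by (rule V.basis_exists)
  obtain C where C: "C \<subseteq> W" "V.independent C" "W \<subseteq> V.span C" "card C = V.dim W"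
    by (rule V.basis_exists)
  have "finite C"
    using finite_independent_subset[OF assms(1)] C by blast
  then show ?thesis
    using V.independent_span_bound[of C B] B C assms(2) by fastforce
qed

text \<open>Supplies strictness for descent on dimensions: a basis of the smaller space extends to
  one of the larger, and two nested finite bases of equal size coincide.\<close>

lemma subspace_dim_eq_finitely_spanned:
  assumes "finitely_spanned s W" "V.subspace V" "V \<subseteq> W" "V.dim W \<le> V.dim V"
  shows "V = W"
proof -
  obtain B where B: "B \<subseteq> V" "V.independent B" "V \<subseteq> V.span B" "card B = V.dim V"
    by (rule V.basis_exists)
  obtain C where C: "B \<subseteq> C" "C \<subseteq> W" "V.independent C" "W \<subseteq> V.span C"
    using V.maximal_independent_subset_extend[of B W] B assms(3) by blast
  have "finite C"
    using finite_independent_subset[OF assms(1)] C by blast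
  moreover have "card C = V.dim W"
    using V.basis_card_eq_dim[of C W] C by blast
  ultimately have "B = C"
    using C(1) B(4) assms(4) by (metis card_seteq)
  then have "W \<subseteq> V.span B" using C by blast
  also have "V.span B \<subseteq> V" using B(1) assms(2) by (rule V.span_minimal)
  finally show ?thesis using assms(3) by blast
qed

lemma dim_span_insert:
  assumes "finitely_spanned s S" "x \<notin> V.span S"
  shows "V.dim (V.span (insert x S)) = Suc (V.dim S)"
proof -
  obtain B where B: "B \<subseteq> S" "V.independent B" "S \<subseteq> V.span B" "card B = V.dim S"
    by (rule V.basis_exists)
  have eq: "V.span B = V.span S"
    by (meson B(1,3) V.span_eq V.span_superset subset_trans)
  have "V.independent (insert x B)"
    using B(2) assms(2) eq by (simp add: V.independent_insertI)
  moreover have "V.span (insert x B) = V.span (insert x S)"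
    using eq V.span_insert[of x B] V.span_insert[of x S] by simp
  ultimately have "V.dim (V.span (insert x S)) = card (insert x B)"
    by (metis V.dim_span_eq_card_independent)
  moreover have "finite B" "x \<notin> B"
    using finite_independent_subset[OF assms(1)] B assms(2) V.span_base by blast+
  ultimately show ?thesis using B(4) by simp
qed

lemma finitely_spanned_span_insert:
  assumes "finitely_spanned s S"
  shows "finitely_spanned s (V.span (insert x S))"
proof -
  obtain B where "finite B" "S \<subseteq> V.span B"
    using assms unfolding finitely_spanned_def by blast
  then have "insert x S \<subseteq> V.span (insert x B)"
    using V.span_mono[of B "insert x B"] V.span_base[of x "insert x B"] by blast
  then have "V.span (insert x S) \<subseteq> V.span (insert x B)"
    by (simp add: V.span_minimal)
  then show ?thesis
    using \<open>finite B\<close> unfolding finitely_spanned_def by (meson finite_insert)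
qed

end

section \<open>Rank-nullity and separating functionals\<close>

context vector_space_pair
begin

text \<open>A basis B of the kernel is extended to a basis C of S; then p is injective on the span
  of C - B and carries C - B to a basis of the image. It will be applied to the projection that
  forgets the lowest block row.\<close>

lemma dim_image_plus_dim_kernel:
  assumes p: "Vector_Spaces.linear s1 s2 p" and S: "vs1.subspace S" "finitely_spanned s1 S"
  shows "vs1.dim S = vs2.dim (p ` S) + vs1.dim {x \<in> S. p x = 0}"
proof -
  define K where "K = {x \<in> S. p x = 0}"
  have K: "vs1.subspace K"
    using vs1.subspace_inter[OF S(1) linear_subspace_kernel[OF p]]
    by (simp add: K_def Collect_conj_eq)
  obtain B where B: "B \<subseteq> K" "vs1.independent B" "K \<subseteq> vs1.span B" "card B = vs1.dim K"
    by (rule vs1.basis_exists)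
  obtain C where C: "B \<subseteq> C" "C \<subseteq> S" "vs1.independent C" "S \<subseteq> vs1.span C"
    using vs1.maximal_independent_subset_extend[of B S] B K_def by blast
  have finC: "finite C"
    using finite_independent_subset[OF vs1.vector_space_axioms S(2)] C by blast
  have dimS: "vs1.dim S = card C"
    using vs1.basis_card_eq_dim[of C S] C by simp
  \<comment> \<open>A vector in both spans has a representation over C supported in C - B and in B
    at once, so it is zero.\<close>
  have disj: "vs1.span (C - B) \<inter> vs1.span B \<subseteq> {0}"
  proof
    fix x assume x: "x \<in> vs1.span (C - B) \<inter> vs1.span B"
    let ?r = "vs1.representation C x"
    have "vs1.representation (C - B) x = ?r" "vs1.representation B x = ?r"
      using x C(1) vs1.representation_extend[OF C(3), of x "C - B"]
        vs1.representation_extend[OF C(3), of x B] by auto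
    then have "?r v = 0" for v
      using vs1.representation_ne_zero[of B x v] vs1.representation_ne_zero[of "C - B" x v]
      by auto
    moreover have "x \<in> vs1.span C"
      using x C(1) vs1.span_mono by blast
    ultimately show "x \<in> {0}"
      using vs1.sum_nonzero_representation_eq[OF C(3), of x] by simp
  qed
  have inj: "inj_on p (vs1.span (C - B))"
  proof (subst linear_inj_on_iff_eq_0[OF p vs1.subspace_span], intro ballI impI)
    fix x assume x: "x \<in> vs1.span (C - B)" "p x = 0"
    have "vs1.span (C - B) \<subseteq> S"
      using C(2) S(1) by (intro vs1.span_minimal) auto
    then have "x \<in> K" using x by (auto simp: K_def)
    then show "x = 0" using x(1) B(3) disj by blast
  qed
  have "vs2.independent (p ` (C - B))"
    using linear_independent_injective_image[OF p _ inj] vs1.independent_mono[OF C(3)] by blast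
  moreover have "p ` (C - B) \<subseteq> p ` S" using C by blast
  moreover have "p ` S \<subseteq> vs2.span (p ` (C - B))"
  proof -
    have "p ` C \<subseteq> vs2.span (p ` (C - B))"
    proof
      fix y assume "y \<in> p ` C"
      then obtain x where x: "x \<in> C" "y = p x" by blast
      show "y \<in> vs2.span (p ` (C - B))"
      proof (cases "x \<in> B")
        case True
        then show ?thesis using B(1) x by (auto simp: K_def vs2.span_zero)
      next
        case False
        then have "y \<in> p ` (C - B)" using x by blast
        then show ?thesis by (rule vs2.span_base)
      qed
    qed
    then have "vs2.span (p ` C) \<subseteq> vs2.span (p ` (C - B))"
      by (simp add: vs2.span_minimal)
    then show ?thesis
      using linear_spans_image[OF p C(4)] by blast
  qed
  ultimately have "vs2.dim (p ` S) = card (p ` (C - B))"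
    using vs2.basis_card_eq_dim[of "p ` (C - B)" "p ` S"] by simp
  also have "\<dots> = card (C - B)"
    using inj vs1.span_superset by (intro card_image) (rule inj_on_subset)
  finally have "vs2.dim (p ` S) = card (C - B)" .
  moreover have "vs1.dim {x \<in> S. p x = 0} = card B" using B(4) K_def by simp
  moreover have "card C = card (C - B) + card B"
    using C(1) finC by (metis card_Diff_subset card_mono finite_subset le_add_diff_inverse2)
  ultimately show ?thesis using dimS by simp
qed

text \<open>Adjoining u to a basis of S gives an independent set, on which values can be prescribed
  and extended linearly.\<close>

lemma linear_functional_separating:
  assumes "vs1.subspace S" "u \<notin> S" "w \<noteq> 0"
  obtains f where "Vector_Spaces.linear s1 s2 f" "\<And>x. x \<in> S \<Longrightarrow> f x = 0" "f u = w"
proof -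
  obtain B where B: "B \<subseteq> S" "vs1.independent B" "S \<subseteq> vs1.span B"
    by (rule vs1.basis_exists)
  have u: "u \<notin> vs1.span B"
    using assms(1,2) B(1) vs1.span_minimal by blast
  then have "vs1.independent (insert u B)" by (simp add: B(2) vs1.independent_insertI)
  from linear_independent_extend[OF this, of "\<lambda>x. if x = u then w else 0"]
  obtain f where f: "Vector_Spaces.linear s1 s2 f"
    "\<forall>x\<in>insert u B. f x = (if x = u then w else 0)" by blast
  have "f x = 0" if "x \<in> B" for x
  proof -
    have "x \<noteq> u" using that u vs1.span_base by blast
    then show ?thesis using f(2) that by (metis insertI2)
  qed
  then have f0: "f x = 0" if "x \<in> S" for x
    using linear_eq_0_on_span[OF f(1)] B(3) that by blast
  have "f u = w" using f(2) by (metis insertI1)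
  from f(1) f0 this show thesis by (rule that)
qed

end


context
  fixes s :: "'k::field \<Rightarrow> 'v::ab_group_add \<Rightarrow> 'v"
  assumes vector_space: "vector_space s"
begin

interpretation V: vector_space s by (rule vector_space)

text \<open>The forms \<open>G p\<close> detect that the \<open>e q\<close> are independent modulo
  S. Linearity is asked for on W only, because the maps of a module are unconstrained outside its
  spaces and forms built from them are linear only there.\<close>

lemma dim_adjoin_dual_system:
  assumes fT: "finite T" and S: "V.subspace S" "finitely_spanned s S"
    and G: "\<And>p x y. p \<in> T \<Longrightarrow> x \<in> W \<Longrightarrow> y \<in> W \<Longrightarrow> G p (x + y) = G p x + G p y"
           "\<And>p x c. p \<in> T \<Longrightarrow> x \<in> W \<Longrightarrow> G p (s c x) = c * G p x"
    and W: "V.subspace W" "S \<subseteq> W" "\<And>q. q \<in> T \<Longrightarrow> e q \<in> W"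
    and GS: "\<And>p x. p \<in> T \<Longrightarrow> x \<in> S \<Longrightarrow> G p x = 0"
    and Ge: "\<And>p q. p \<in> T \<Longrightarrow> q \<in> T \<Longrightarrow> G p (e q) = (if p = q then 1 else 0)"
  shows "V.dim (V.span (S \<union> e ` T)) = V.dim S + card T \<and> finitely_spanned s (V.span (S \<union> e ` T))"
  using fT G W(3) GS Ge
proof (induction T rule: finite_induct)
  case empty
  then show ?case using S by (simp add: V.span_eq_iff[THEN iffD2, OF S(1)])
next
  case (insert t T)
  let ?S = "V.span (S \<union> e ` T)"
  have IH: "V.dim ?S = V.dim S + card T" "finitely_spanned s ?S"
    using insert.IH insert.prems by auto
  have G: "G t (x + y) = G t x + G t y" "G t (s c x) = c * G t x" if "x \<in> W" "y \<in> W" for x y c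
    using insert.prems(1,2) that by auto
  have sub: "V.subspace {x \<in> W. G t x = 0}"
  proof (rule V.subspaceI)
    show "0 \<in> {x \<in> W. G t x = 0}"
      using G(2)[of 0 0 0] V.subspace_0[OF W(1)] by simp
  qed (use G W(1) V.subspace_add V.subspace_scale in auto)
  \<comment> \<open>S and the vectors adjoined earlier lie in the kernel of \<open>G t\<close>,
    whereas \<open>G t (e t) = 1\<close>; so \<open>e t\<close> is a new direction.\<close>
  have "S \<union> e ` T \<subseteq> {x \<in> W. G t x = 0}"
    using insert.prems insert.hyps(2) W(2) by auto
  then have "?S \<subseteq> {x \<in> W. G t x = 0}"
    using sub by (rule V.span_minimal)
  then have "e t \<notin> ?S" using insert.prems(5)[of t t] by auto
  then have "e t \<notin> V.span ?S" by (simp add: V.span_span)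
  from dim_span_insert[OF vector_space IH(2) this] have "V.dim (V.span (insert (e t) ?S)) = Suc (V.dim ?S)" .
  moreover have "V.span (insert (e t) ?S) = V.span (S \<union> e ` insert t T)"
    using V.span_insert[of "e t" ?S] V.span_insert[of "e t" "S \<union> e ` T"]
    by (simp add: V.span_span)
  ultimately show ?case
    using IH finitely_spanned_span_insert[OF vector_space IH(2), of "e t"] insert.hyps by simp
qed

end

section \<open>Direct sums of submodules\<close>

locale poset_module =
  fixes s :: "'k::field \<Rightarrow> 'v::ab_group_add \<Rightarrow> 'v"
    and P :: "'p::order set"
    and M :: "('p, 'v) pmodule"
  assumes pmodule: "is_pmodule s P M"
begin

sublocale V: vector_space s
  using pmodule by (simp add: is_pmodule_def)

lemma subspace_vspace: "x \<in> P \<Longrightarrow> V.subspace (vspace M x)"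
  using pmodule by (simp add: is_pmodule_def)

lemma finitely_spanned_vspace: "x \<in> P \<Longrightarrow> finitely_spanned s (vspace M x)"
  using pmodule unfolding is_pmodule_def finitely_spanned_def by (metis order_refl)

lemma zero_in_vspace: "x \<in> P \<Longrightarrow> 0 \<in> vspace M x"
  by (simp add: V.subspace_0 subspace_vspace)

lemma struct_map_linear:
  "x \<in> P \<Longrightarrow> y \<in> P \<Longrightarrow> x \<le> y \<Longrightarrow> linear_map_on s s (vspace M x) (vspace M y) (struct_map M y x)"
  using pmodule by (simp add: is_pmodule_def)

lemma struct_map_in:
  "x \<in> P \<Longrightarrow> y \<in> P \<Longrightarrow> x \<le> y \<Longrightarrow> v \<in> vspace M x \<Longrightarrow> struct_map M y x v \<in> vspace M y"
  using struct_map_linear[of x y] by (simp add: linear_map_on_def)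

lemma struct_map_add:
  "x \<in> P \<Longrightarrow> y \<in> P \<Longrightarrow> x \<le> y \<Longrightarrow> u \<in> vspace M x \<Longrightarrow> v \<in> vspace M x \<Longrightarrow>
   struct_map M y x (u + v) = struct_map M y x u + struct_map M y x v"
  using struct_map_linear[of x y] by (simp add: linear_map_on_def)

lemma struct_map_scale:
  "x \<in> P \<Longrightarrow> y \<in> P \<Longrightarrow> x \<le> y \<Longrightarrow> v \<in> vspace M x \<Longrightarrow>
   struct_map M y x (s t v) = s t (struct_map M y x v)"
  using struct_map_linear[of x y] by (simp add: linear_map_on_def)

lemma struct_map_zero:
  assumes "x \<in> P" "y \<in> P" "x \<le> y"
  shows "struct_map M y x 0 = 0"
  using struct_map_scale[OF assms zero_in_vspace[OF assms(1)], of 0] by simp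

lemma struct_map_sum:
  assumes "x \<in> P" "y \<in> P" "x \<le> y" "finite A" "\<And>i. i \<in> A \<Longrightarrow> u i \<in> vspace M x"
  shows "struct_map M y x (\<Sum>i\<in>A. u i) = (\<Sum>i\<in>A. struct_map M y x (u i))"
  using assms(4,5)
proof (induction A rule: finite_induct)
  case empty
  then show ?case using assms by (simp add: struct_map_zero)
next
  case (insert i A)
  then show ?case
    using assms by (simp add: struct_map_add V.subspace_sum subspace_vspace)
qed

lemma struct_map_refl: "x \<in> P \<Longrightarrow> v \<in> vspace M x \<Longrightarrow> struct_map M x x v = v"
  using pmodule by (simp add: is_pmodule_def)

lemma struct_map_comp:
  "x \<in> P \<Longrightarrow> y \<in> P \<Longrightarrow> z \<in> P \<Longrightarrow> x \<le> y \<Longrightarrow> y \<le> z \<Longrightarrow> v \<in> vspace M x \<Longrightarrow>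
   struct_map M z y (struct_map M y x v) = struct_map M z x v"
  using pmodule unfolding is_pmodule_def by metis

lemma submodule_is_pmodule:
  assumes "is_submodule s P M U"
  shows "is_pmodule s P (M\<lparr>vspace := U\<rparr>)"
proof -
  have sub: "V.subspace (U x)" "U x \<subseteq> vspace M x" if "x \<in> P" for x
    using assms that by (auto simp: is_submodule_def)
  have fin: "\<exists>B. finite B \<and> U x = V.span B" if x: "x \<in> P" for x
  proof -
    obtain B where B: "B \<subseteq> U x" "V.independent B" "U x \<subseteq> V.span B" "card B = V.dim (U x)"
      by (rule V.basis_exists)
    have "finitely_spanned s (U x)"
      using finitely_spanned_subset[OF V.vector_space_axioms finitely_spanned_vspace] sub x by blast
    then have "finite B"
      using finite_independent_subset[OF V.vector_space_axioms] B by blast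
    then show ?thesis
      using B V.span_minimal[OF B(1) sub(1)[OF x]] by (metis antisym)
  qed
  have lin: "linear_map_on s s (U x) (U y) (struct_map M y x)" if "x \<in> P" "y \<in> P" "x \<le> y" for x y
    unfolding linear_map_on_def
    using struct_map_add[of x y] struct_map_scale[of x y] assms sub[of x] that
    by (auto simp: is_submodule_def subset_iff)
  show ?thesis
    unfolding is_pmodule_def
    using V.vector_space_axioms sub fin lin struct_map_refl struct_map_comp
    by (simp add: subset_iff)
qed

text \<open>Subtracting two decompositions of the same vector reduces uniqueness to the zero vector.
  The family of parts is unique as a function because \<open>is_direct_sum\<close> pins it to 0 from
  index r on.\<close>

lemma is_direct_sumI:
  assumes "\<And>i. i < r \<Longrightarrow> is_submodule s P M (U i)"
    and ex: "\<And>x v. x \<in> P \<Longrightarrow> v \<in> vspace M x \<Longrightarrow> \<exists>u. (\<forall>i<r. u i \<in> U i x) \<and> v = (\<Sum>i<r. u i)"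
    and zero: "\<And>x u. x \<in> P \<Longrightarrow> (\<And>i. i < r \<Longrightarrow> u i \<in> U i x) \<Longrightarrow> (\<Sum>i<r. u i) = 0 \<Longrightarrow> (\<And>i. i < r \<Longrightarrow> u i = 0)"
  shows "is_direct_sum s P M r U"
  unfolding is_direct_sum_def
proof (intro conjI allI impI ballI)
  fix x v assume x: "x \<in> P" and v: "v \<in> vspace M x"
  obtain u where u: "\<forall>i<r. u i \<in> U i x" "v = (\<Sum>i<r. u i)"
    using ex[OF x v] by blast
  show "\<exists>!u. (\<forall>i<r. u i \<in> U i x) \<and> (\<forall>i\<ge>r. u i = 0) \<and> v = (\<Sum>i<r. u i)"
  proof (rule ex1I[of _ "\<lambda>i. if i < r then u i else 0"])
    show "(\<forall>i<r. (if i < r then u i else 0) \<in> U i x) \<and> (\<forall>i\<ge>r. (if i < r then u i else 0) = 0) \<and>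
      v = (\<Sum>i<r. (if i < r then u i else 0))"
      using u by simp
  next
    fix w assume w: "(\<forall>i<r. w i \<in> U i x) \<and> (\<forall>i\<ge>r. w i = 0) \<and> v = (\<Sum>i<r. w i)"
    have "w i - u i = 0" if "i < r" for i
    proof (rule zero[OF x, of "\<lambda>i. w i - u i"])
      show "w i - u i \<in> U i x" if "i < r" for i
        using that u w x assms(1)[OF that] by (auto simp: is_submodule_def V.subspace_diff)
      show "(\<Sum>i<r. w i - u i) = 0"
        using u(2) w by (simp add: sum_subtractf)
    qed (rule that)
    then show "w = (\<lambda>i. if i < r then u i else 0)"
      using w by auto
  qed
qed (use assms(1) in auto)

end

locale direct_sum_decomposition = poset_module s P M
  for s :: "'k::field \<Rightarrow> 'v::ab_group_add \<Rightarrow> 'v" and P :: "'p::order set" and M :: "('p, 'v) pmodule" +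
  fixes r :: nat and U :: "nat \<Rightarrow> 'p \<Rightarrow> 'v set"
  assumes direct_sum: "is_direct_sum s P M r U"
begin

lemma submodule: "i < r \<Longrightarrow> is_submodule s P M (U i)"
  using direct_sum by (simp add: is_direct_sum_def)

lemma subspace_summand: "i < r \<Longrightarrow> x \<in> P \<Longrightarrow> V.subspace (U i x)"
  using submodule by (simp add: is_submodule_def)

lemma summand_subset: "i < r \<Longrightarrow> x \<in> P \<Longrightarrow> v \<in> U i x \<Longrightarrow> v \<in> vspace M x"
  using submodule by (auto simp: is_submodule_def)

lemma struct_map_summand:
  "i < r \<Longrightarrow> x \<in> P \<Longrightarrow> y \<in> P \<Longrightarrow> x \<le> y \<Longrightarrow> v \<in> U i x \<Longrightarrow> struct_map M y x v \<in> U i y"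
  using submodule by (auto simp: is_submodule_def)

text \<open>Projection onto the q-th summand. Uniqueness concerns the whole family of parts, so the
  family is selected first and evaluated at q afterwards.\<close>

definition component :: "nat \<Rightarrow> 'p \<Rightarrow> 'v \<Rightarrow> 'v" where
  "component q x v =
     (THE u. (\<forall>i<r. u i \<in> U i x) \<and> (\<forall>i\<ge>r. u i = 0) \<and> v = (\<Sum>i<r. u i)) q"

lemma component:
  assumes "x \<in> P" "v \<in> vspace M x"
  shows component_in: "i < r \<Longrightarrow> component i x v \<in> U i x"
    and sum_component: "(\<Sum>i<r. component i x v) = v"
proof -
  have "\<exists>!u. (\<forall>i<r. u i \<in> U i x) \<and> (\<forall>i\<ge>r. u i = 0) \<and> v = (\<Sum>i<r. u i)"
    using direct_sum assms by (simp add: is_direct_sum_def)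
  from theI'[OF this]
  show "i < r \<Longrightarrow> component i x v \<in> U i x" "(\<Sum>i<r. component i x v) = v"
    by (simp_all add: component_def)
qed

lemma component_unique:
  assumes x: "x \<in> P" and u: "\<And>i. i < r \<Longrightarrow> u i \<in> U i x" and q: "q < r"
  shows "component q x (\<Sum>i<r. u i) = u q"
proof -
  let ?v = "\<Sum>i<r. u i" and ?u = "\<lambda>i. if i < r then u i else 0"
  let ?Q = "\<lambda>w. (\<forall>i<r. w i \<in> U i x) \<and> (\<forall>i\<ge>r. w i = 0) \<and> ?v = (\<Sum>i<r. w i)"
  have "?v \<in> vspace M x"
    using u x summand_subset by (auto intro!: V.subspace_sum subspace_vspace)
  then have "\<exists>!w. ?Q w"
    using direct_sum x by (simp add: is_direct_sum_def)
  moreover have "?Q ?u"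
    using u by simp
  ultimately have "(THE w. ?Q w) = ?u"
    by (rule the1_equality[of ?Q])
  then show ?thesis using q by (simp add: component_def)
qed

lemma component_eqI:
  assumes "x \<in> P" "\<And>i. i < r \<Longrightarrow> u i \<in> U i x" "q < r" "v = (\<Sum>i<r. u i)"
  shows "component q x v = u q"
  using component_unique[OF assms(1-3)] assms(4) by simp

lemma component_add:
  assumes "x \<in> P" "u \<in> vspace M x" "v \<in> vspace M x" "q < r"
  shows "component q x (u + v) = component q x u + component q x v"
  using assms
  by (intro component_eqI) (auto simp: component_in sum_component sum.distrib intro!: V.subspace_add subspace_summand)

lemma component_scale:
  assumes "x \<in> P" "v \<in> vspace M x" "q < r"
  shows "component q x (s t v) = s t (component q x v)"
  using assms
  by (intro component_eqI)
     (auto simp: component_in sum_component V.scale_sum_right[symmetric] intro!: V.subspace_scale subspace_summand)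

text \<open>Submodules are stable under structure maps, so mapping the parts of v decomposes the
  image of v. The projections are thus morphisms of modules.\<close>

lemma component_struct_map:
  assumes "x \<in> P" "y \<in> P" "x \<le> y" "v \<in> vspace M x" "q < r"
  shows "component q y (struct_map M y x v) = struct_map M y x (component q x v)"
proof (rule component_eqI[OF assms(2) _ assms(5)])
  show "struct_map M y x (component i x v) \<in> U i y" if "i < r" for i
    using assms that by (auto intro: struct_map_summand component_in)
  have "struct_map M y x (\<Sum>i<r. component i x v) = (\<Sum>i<r. struct_map M y x (component i x v))"
    using assms by (intro struct_map_sum) (auto intro: summand_subset component_in)
  then show "struct_map M y x v = (\<Sum>i<r. struct_map M y x (component i x v))"
    using assms by (simp add: sum_component)
qed

lemma component_summand:
  assumes "x \<in> P" "p < r" "q < r" "u \<in> U p x"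
  shows "component q x u = (if q = p then u else 0)"
  using assms by (intro component_eqI) (auto simp: V.subspace_0 subspace_summand)

lemma summands_independent:
  assumes "x \<in> P" "\<And>i. i < r \<Longrightarrow> u i \<in> U i x" "(\<Sum>i<r. u i) = 0" "q < r"
  shows "u q = 0"
proof -
  have "component q x 0 = u q"
    using assms by (intro component_eqI) auto
  moreover have "component q x 0 = 0"
    using assms(1,4) by (intro component_eqI) (auto simp: V.subspace_0 subspace_summand)
  ultimately show ?thesis by simp
qed

end

section \<open>Morphisms from and to an interval module\<close>

text \<open>A morphism \<open>V\<^sub>I \<rightarrow> M\<close> is encoded by the family of images \<open>f x\<close> of \<open>1\<close>.  Naturality squares
  are imposed only where they do not hold trivially: for \<open>V\<^sub>I \<rightarrow> M\<close> those starting in \<open>I\<close>, for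
  \<open>M \<rightarrow> V\<^sub>I\<close> those ending in \<open>I\<close>.\<close>

definition hom_from :: "'p::order set \<Rightarrow> 'p set \<Rightarrow> ('p, 'v::ab_group_add) pmodule \<Rightarrow> ('p \<Rightarrow> 'v) \<Rightarrow> bool" where
  "hom_from P I M f \<longleftrightarrow>
     (\<forall>x\<in>P. f x \<in> vspace M x \<and> (x \<notin> I \<longrightarrow> f x = 0)) \<and>
     (\<forall>x\<in>P \<inter> I. \<forall>y\<in>P. x \<le> y \<longrightarrow> struct_map M y x (f x) = f y)"

definition hom_to :: "('k::field \<Rightarrow> 'v::ab_group_add \<Rightarrow> 'v) \<Rightarrow> 'p::order set \<Rightarrow> 'p set
    \<Rightarrow> ('p, 'v) pmodule \<Rightarrow> ('p \<Rightarrow> 'v \<Rightarrow> 'k) \<Rightarrow> bool" where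
  "hom_to s P I M g \<longleftrightarrow>
     (\<forall>x\<in>P. linear_map_on s (*) (vspace M x) UNIV (g x) \<and> (x \<notin> I \<longrightarrow> (\<forall>v\<in>vspace M x. g x v = 0))) \<and>
     (\<forall>x\<in>P. \<forall>y\<in>P \<inter> I. x \<le> y \<longrightarrow> (\<forall>v\<in>vspace M x. g y (struct_map M y x v) = g x v))"

context poset_module
begin

lemma hom_to_add:
  "hom_to s P I M g \<Longrightarrow> x \<in> P \<Longrightarrow> u \<in> vspace M x \<Longrightarrow> v \<in> vspace M x \<Longrightarrow> g x (u + v) = g x u + g x v"
  by (simp add: hom_to_def linear_map_on_def)

lemma hom_to_scale:
  "hom_to s P I M g \<Longrightarrow> x \<in> P \<Longrightarrow> v \<in> vspace M x \<Longrightarrow> g x (s t v) = t * g x v"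
  by (simp add: hom_to_def linear_map_on_def)

lemma hom_to_zero:
  "hom_to s P I M g \<Longrightarrow> x \<in> P \<Longrightarrow> g x 0 = 0"
  using hom_to_scale[of I g x 0 0] by (simp add: zero_in_vspace)

lemma hom_to_diff:
  "hom_to s P I M g \<Longrightarrow> x \<in> P \<Longrightarrow> u \<in> vspace M x \<Longrightarrow> v \<in> vspace M x \<Longrightarrow> g x (u - v) = g x u - g x v"
  using hom_to_add[of I g x u "s (- 1) v"] hom_to_scale[of I g x v "- 1"]
  by (simp add: V.subspace_neg subspace_vspace)

lemma hom_to_sum:
  assumes "hom_to s P I M g" "x \<in> P" "finite A" "\<And>i. i \<in> A \<Longrightarrow> u i \<in> vspace M x"
  shows "g x (\<Sum>i\<in>A. u i) = (\<Sum>i\<in>A. g x (u i))"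
  using assms(3,4)
proof (induction A rule: finite_induct)
  case empty
  then show ?case using assms by (simp add: hom_to_zero)
next
  case (insert i A)
  then show ?case
    using assms(1,2) by (simp add: hom_to_add V.subspace_sum subspace_vspace)
qed

text \<open>If the composite \<open>V\<^sub>I \<rightarrow> M \<rightarrow> V\<^sub>I\<close> is nonzero it is an invertible scalar, since \<open>I\<close> is
  connected; hence \<open>V\<^sub>I\<close> splits off \<open>M\<close>.\<close>

lemma iso_interval_module_if_composite_nonzero:
  assumes ind: "indecomposable s P M" and IP: "I \<subseteq> P" and con: "poset_connected I"
    and f: "hom_from P I M f" and g: "hom_to s P I M g"
    and z: "z \<in> I" "g z (f z) \<noteq> 0"
  shows "pmodule_iso s (*) P M (interval_module I)"
proof -
  define c where "c = g z (f z)"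
  have f_in: "f x \<in> vspace M x" if "x \<in> P" for x
    using f that by (simp add: hom_from_def)
  have step: "g x (f x) = g y (f y)" if "x \<in> I" "y \<in> I" "x \<le> y" for x y
    using f g that IP by (auto simp: hom_from_def hom_to_def subset_iff) (metis IntI)
  have const: "g x (f x) = c" if x: "x \<in> I" for x
  proof -
    have "(z, x) \<in> {(u, v). u \<in> I \<and> v \<in> I \<and> (u \<le> v \<or> v \<le> u)}\<^sup>*"
      using con z(1) x by (simp add: poset_connected_def)
    then show ?thesis
      by (induction rule: rtrancl_induct) (auto simp: c_def dest: step)
  qed
  have outside: "f x = 0" "v \<in> vspace M x \<Longrightarrow> g x v = 0" if "x \<in> P" "x \<notin> I" for x v
    using f g that by (auto simp: hom_from_def hom_to_def)
  \<comment> \<open>Image of f and kernel of g. On I, g after f is multiplication by c, so f after g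
    divided by c is an idempotent endomorphism with this image and kernel.\<close>
  define W where "W = (\<lambda>i::nat. \<lambda>x. if i = 0 then range (\<lambda>t. s t (f x)) else {v \<in> vspace M x. g x v = 0})"
  have sub0: "is_submodule s P M (W 0)"
    unfolding is_submodule_def
  proof (intro conjI ballI impI)
    fix x assume x: "x \<in> P"
    show "V.subspace (W 0 x)"
      unfolding W_def by (simp flip: V.span_singleton)
    show "W 0 x \<subseteq> vspace M x"
      using x f_in by (auto simp: W_def V.subspace_scale subspace_vspace)
  next
    fix x y v assume xy: "x \<in> P" "y \<in> P" "x \<le> y" and "v \<in> W 0 x"
    then obtain t where t: "v = s t (f x)" by (auto simp: W_def)
    show "struct_map M y x v \<in> W 0 y"
    proof (cases "x \<in> I")
      case True
      then have "struct_map M y x (f x) = f y" using f xy by (simp add: hom_from_def)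
      then show ?thesis using xy f_in t by (auto simp: struct_map_scale W_def)
    next
      case False
      then have "struct_map M y x v = s 0 (f y)" using t xy by (simp add: outside struct_map_zero)
      then show ?thesis unfolding W_def by auto
    qed
  qed
  have sub1: "is_submodule s P M (W 1)"
    unfolding is_submodule_def
  proof (intro conjI ballI impI)
    fix x assume x: "x \<in> P"
    show "V.subspace (W 1 x)"
      unfolding W_def using x g
      by (intro V.subspaceI)
         (auto simp: zero_in_vspace hom_to_zero hom_to_add hom_to_scale V.subspace_add
           V.subspace_scale subspace_vspace)
    show "W 1 x \<subseteq> vspace M x" by (auto simp: W_def)
  next
    fix x y v assume xy: "x \<in> P" "y \<in> P" "x \<le> y" and v: "v \<in> W 1 x"
    have "g y (struct_map M y x v) = 0"
      using xy v g outside(2)[of y] by (cases "y \<in> I") (auto simp: W_def hom_to_def struct_map_in)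
    then show "struct_map M y x v \<in> W 1 y"
      using xy v by (auto simp: W_def struct_map_in)
  qed
  have "is_direct_sum s P M 2 W"
  proof (rule is_direct_sumI)
    fix i :: nat assume "i < 2"
    then show "is_submodule s P M (W i)" using sub0 sub1 by (auto simp: less_2_cases_iff)
  next
    fix x v assume x: "x \<in> P" and v: "v \<in> vspace M x"
    \<comment> \<open>The coefficient of v along \<open>f x\<close>; division by c makes the
      remainder vanish under g.\<close>
    let ?t = "g x v / c"
    have tf: "s ?t (f x) \<in> vspace M x"
      using x f_in by (simp add: V.subspace_scale subspace_vspace)
    have "g x (v - s ?t (f x)) = 0"
    proof (cases "x \<in> I")
      case True
      have "g x (v - s ?t (f x)) = g x v - ?t * g x (f x)"
        using g x v tf f_in by (simp add: hom_to_diff hom_to_scale)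
      then show ?thesis using const[OF True] z(2) c_def by simp
    next
      case False
      then show ?thesis using x v tf by (auto intro!: outside V.subspace_diff subspace_vspace)
    qed
    then have "v - s ?t (f x) \<in> W 1 x"
      using x v tf by (simp add: W_def V.subspace_diff subspace_vspace)
    moreover have "s ?t (f x) \<in> W 0 x" unfolding W_def by auto
    ultimately show "\<exists>u. (\<forall>i<2. u i \<in> W i x) \<and> v = (\<Sum>i<2. u i)"
      by (intro exI[of _ "\<lambda>i::nat. if i = 0 then s ?t (f x) else v - s ?t (f x)"])
         (auto simp: less_Suc_eq numeral_2_eq_2)
  next
    fix x and u :: "nat \<Rightarrow> 'v" and i :: nat
    assume x: "x \<in> P" and u: "\<And>i. i < 2 \<Longrightarrow> u i \<in> W i x" and sum: "(\<Sum>i<2. u i) = 0" and i: "i < 2"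
    obtain t where t: "u 0 = s t (f x)" using u[of 0] by (auto simp: W_def)
    have u1: "u 1 \<in> vspace M x" "g x (u 1) = 0" using u[of 1] by (auto simp: W_def)
    have u01: "u 0 + u 1 = 0" using sum by (simp add: numeral_2_eq_2)
    have "u 0 = 0"
    proof (cases "x \<in> I")
      case True
      have "g x (u 0 + u 1) = t * c"
        using t u1 x g f_in const[OF True]
        by (simp add: hom_to_add hom_to_scale V.subspace_scale subspace_vspace)
      then have "t * c = 0" using u01 g x by (simp add: hom_to_zero)
      then show ?thesis using t z(2) c_def by simp
    next
      case False
      then show ?thesis using t x by (simp add: outside)
    qed
    then show "u i = 0" using u01 i by (auto simp: less_2_cases_iff)
  qed
  then have "(\<forall>x\<in>P. W 0 x = {0}) \<or> (\<forall>x\<in>P. W 1 x = {0})"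
    using ind by (simp add: indecomposable_def)
  moreover have "W 0 z \<noteq> {0}"
  proof
    assume "W 0 z = {0}"
    moreover have "s 1 (f z) \<in> range (\<lambda>t. s t (f z))" by (rule rangeI)
    ultimately have "f z = 0" by (simp add: W_def)
    then show False using z IP g by (auto simp: hom_to_zero)
  qed
  \<comment> \<open>The image of f is nonzero at z, so indecomposability forces the kernel of g to
    vanish at every point.\<close>
  ultimately have W1: "W 1 x = {0}" if "x \<in> P" for x using that z(1) IP by blast
  have ker: "v = 0" if "x \<in> P" "v \<in> vspace M x" "g x v = 0" for x v
    using W1[OF that(1)] that by (auto simp: W_def)
  let ?N = "interval_module I :: ('p, 'k) pmodule"
  have "linear_map_on s (*) (vspace M x) (vspace ?N x) (g x) \<and> bij_betw (g x) (vspace M x) (vspace ?N x)"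
    if x: "x \<in> P" for x
  proof
    show "linear_map_on s (*) (vspace M x) (vspace ?N x) (g x)"
      using g x outside(2)[OF x] by (auto simp: hom_to_def linear_map_on_def interval_module_def)
    have "inj_on (g x) (vspace M x)"
    proof (rule inj_onI)
      fix u v assume "u \<in> vspace M x" "v \<in> vspace M x" "g x u = g x v"
      then have "u - v = 0"
        using x g by (intro ker[OF x]) (auto simp: hom_to_diff V.subspace_diff subspace_vspace)
      then show "u = v" by simp
    qed
    moreover have "g x ` vspace M x = vspace ?N x"
    proof (cases "x \<in> I")
      case True
      have "t \<in> g x ` vspace M x" for t
      proof (rule image_eqI[of _ _ "s (t / c) (f x)"])
        show "t = g x (s (t / c) (f x))"
          using g x f_in const[OF True] z(2) c_def by (simp add: hom_to_scale)
      qed (use x f_in in \<open>simp add: V.subspace_scale subspace_vspace\<close>)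
      then show ?thesis using True by (auto simp: interval_module_def)
    next
      case False
      then show ?thesis
        using outside(2)[OF x False] zero_in_vspace[OF x]
        by (auto simp: interval_module_def intro!: image_eqI[of _ _ 0])
    qed
    ultimately show "bij_betw (g x) (vspace M x) (vspace ?N x)" by (simp add: bij_betw_def)
  qed
  moreover have "g y (struct_map M y x v) = struct_map ?N y x (g x v)"
    if xy: "x \<in> P" "y \<in> P" "x \<le> y" and v: "v \<in> vspace M x" for x y v
  proof (cases "y \<in> I")
    case True
    then have "g y (struct_map M y x v) = g x v" using g xy v by (simp add: hom_to_def)
    then show ?thesis using True outside(2)[of x] xy v by (auto simp: interval_module_def)
  next
    case False
    then show ?thesis using outside(2)[of y] xy v struct_map_in by (auto simp: interval_module_def)
  qed
  ultimately show ?thesis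
    unfolding pmodule_iso_def by (intro exI[of _ g]) auto
qed

text \<open>Over I, the isomorphism g has the field as target and \<open>f x\<close> is the preimage
  of 1; each space of M there is a line with basis vector \<open>f x\<close> and coordinate
  \<open>g x\<close>.\<close>

lemma iso_interval_module_generators:
  assumes iso: "pmodule_iso s (*) P M (interval_module I)" and IP: "I \<subseteq> P"
  obtains f g where "hom_from P I M f" "hom_to s P I M g"
    "\<And>x. x \<in> I \<Longrightarrow> g x (f x) = 1"
    "\<And>x v. x \<in> I \<Longrightarrow> v \<in> vspace M x \<Longrightarrow> s (g x v) (f x) = v"
proof -
  let ?N = "interval_module I :: ('p, 'k) pmodule"
  obtain g where "\<forall>x\<in>P. linear_map_on s (*) (vspace M x) (vspace ?N x) (g x) \<and>
                   bij_betw (g x) (vspace M x) (vspace ?N x)"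
      "\<forall>x\<in>P. \<forall>y\<in>P. x \<le> y \<longrightarrow>
        (\<forall>v\<in>vspace M x. g y (struct_map M y x v) = struct_map ?N y x (g x v))"
    using iso unfolding pmodule_iso_def by (elim exE conjE)
  then have g: "\<And>x. x \<in> P \<Longrightarrow> linear_map_on s (*) (vspace M x) (vspace ?N x) (g x)"
      "\<And>x. x \<in> P \<Longrightarrow> bij_betw (g x) (vspace M x) (vspace ?N x)"
      "\<And>x y v. x \<in> P \<Longrightarrow> y \<in> P \<Longrightarrow> x \<le> y \<Longrightarrow> v \<in> vspace M x \<Longrightarrow>
         g y (struct_map M y x v) = struct_map ?N y x (g x v)"
    by simp_all
  have g_out: "g x v = 0" if "x \<in> P" "x \<notin> I" "v \<in> vspace M x" for x v
    using g(1)[of x] that by (auto simp: linear_map_on_def interval_module_def)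
  have hg: "hom_to s P I M g"
    unfolding hom_to_def
  proof (intro conjI ballI impI)
    fix x assume "x \<in> P"
    then show "linear_map_on s (*) (vspace M x) UNIV (g x)"
      using g(1)[of x] by (simp add: linear_map_on_def)
  next
    fix x y v assume "x \<in> P" "y \<in> P \<inter> I" "x \<le> y" "v \<in> vspace M x"
    then show "g y (struct_map M y x v) = g x v"
      using g(3)[of x y v] g_out[of x v] by (auto simp: interval_module_def)
  qed (use g_out in auto)
  define f where "f = (\<lambda>x. if x \<in> I then inv_into (vspace M x) (g x) 1 else 0)"
  have f: "f x \<in> vspace M x" "g x (f x) = 1" if x: "x \<in> I" for x
  proof -
    have "1 \<in> g x ` vspace M x"
      using g(2)[of x] x IP by (auto simp: bij_betw_def interval_module_def)
    then show "f x \<in> vspace M x" "g x (f x) = 1"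
      using x by (simp_all add: f_def inv_into_into f_inv_into_f)
  qed
  have inj: "u = v" if "x \<in> P" "u \<in> vspace M x" "v \<in> vspace M x" "g x u = g x v" for x u v
    using g(2)[OF that(1)] that by (auto simp: bij_betw_def inj_on_def)
  have f_in: "f x \<in> vspace M x" if "x \<in> P" for x
    using f that by (cases "x \<in> I") (simp_all add: f_def zero_in_vspace)
  have hf: "hom_from P I M f"
    unfolding hom_from_def
  proof (intro conjI ballI impI)
    fix x y assume x: "x \<in> P \<inter> I" and y: "y \<in> P" and xy: "x \<le> y"
    have "g y (struct_map M y x (f x)) = g y (f y)"
    proof (cases "y \<in> I")
      case True
      then show ?thesis using g(3)[of x y "f x"] f x y xy by (simp add: interval_module_def)
    next
      case False
      then show ?thesis using g_out[of y] f_in x y xy struct_map_in by auto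
    qed
    then show "struct_map M y x (f x) = f y"
      using x y xy by (intro inj) (auto simp: struct_map_in f_in)
  qed (use f_in in \<open>simp_all add: f_def\<close>)
  have "s (g x v) (f x) = v" if "x \<in> I" "v \<in> vspace M x" for x v
    using that IP f[OF that(1)] hg
    by (intro inj[of x]) (auto simp: hom_to_scale V.subspace_scale subspace_vspace)
  with hf hg f(2) show thesis by (rule that)
qed

end

context direct_sum_decomposition
begin

lemma summand_module: "q < r \<Longrightarrow> poset_module s P (M\<lparr>vspace := U q\<rparr>)"
  using submodule_is_pmodule[OF submodule] by (simp add: poset_module_def)

lemma hom_from_component:
  assumes "hom_from P I M f" "q < r"
  shows "hom_from P I (M\<lparr>vspace := U q\<rparr>) (\<lambda>x. component q x (f x))"
  using assms component_struct_map[symmetric]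
  by (auto simp: hom_from_def component_in component_summand V.subspace_0 subspace_summand)

lemma hom_from_summand:
  assumes "hom_from P I (M\<lparr>vspace := U q\<rparr>) f" "q < r"
  shows "hom_from P I M f"
  using assms by (auto simp: hom_from_def summand_subset)

lemma hom_to_summand:
  assumes "hom_to s P I M g" "q < r"
  shows "hom_to s P I (M\<lparr>vspace := U q\<rparr>) g"
  using assms summand_subset by (auto simp: hom_to_def linear_map_on_def)

lemma hom_to_component:
  assumes "hom_to s P I (M\<lparr>vspace := U q\<rparr>) g" "q < r"
  shows "hom_to s P I M (\<lambda>x v. g x (component q x v))"
  using assms
  by (auto simp: hom_to_def linear_map_on_def component_add component_scale component_in
      component_struct_map)

text \<open>A composite V_I -> M -> V_I is the sum of its parts through the summands. A summand
  isomorphic to V_I contributes a product of two coordinates; any other contributes 0, since a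
  nonzero composite through it would make it isomorphic to V_I. On the generators of the summands in
  T the pairing is the identity matrix.\<close>

lemma interval_summands_dual_system:
  assumes ind: "\<And>q. q < r \<Longrightarrow> indecomposable s P (M\<lparr>vspace := U q\<rparr>)"
    and IP: "I \<subseteq> P" and con: "poset_connected I"
  defines "T \<equiv> {q. q < r \<and> pmodule_iso s (*) P (M\<lparr>vspace := U q\<rparr>) (interval_module I)}"
  obtains F G where
    "\<And>q. q \<in> T \<Longrightarrow> hom_from P I M (F q)" "\<And>q. q \<in> T \<Longrightarrow> hom_to s P I M (G q)"
    "\<And>p q x. p \<in> T \<Longrightarrow> q \<in> T \<Longrightarrow> x \<in> I \<Longrightarrow> G p x (F q x) = (if p = q then 1 else 0)"
    "\<And>f g x. hom_from P I M f \<Longrightarrow> hom_to s P I M g \<Longrightarrow> x \<in> I \<Longrightarrow>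
       g x (f x) = (\<Sum>q\<in>T. G q x (f x) * g x (F q x))"
proof -
  have "\<exists>f g. hom_from P I (M\<lparr>vspace := U q\<rparr>) f \<and> hom_to s P I (M\<lparr>vspace := U q\<rparr>) g \<and>
      (\<forall>x\<in>I. g x (f x) = 1) \<and> (\<forall>x\<in>I. \<forall>v\<in>U q x. s (g x v) (f x) = v)" if q: "q \<in> T" for q
  proof -
    interpret Q: poset_module s P "M\<lparr>vspace := U q\<rparr>"
      using q summand_module by (simp add: T_def)
    show ?thesis
      using Q.iso_interval_module_generators[of I] q IP unfolding T_def
      by (metis (no_types, lifting) mem_Collect_eq pmodule.select_convs(1) pmodule.surjective pmodule.update_convs(1))
  qed
  then obtain F G where FG: "\<And>q. q \<in> T \<Longrightarrow> hom_from P I (M\<lparr>vspace := U q\<rparr>) (F q)"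
      "\<And>q. q \<in> T \<Longrightarrow> hom_to s P I (M\<lparr>vspace := U q\<rparr>) (G q)"
      "\<And>q x. q \<in> T \<Longrightarrow> x \<in> I \<Longrightarrow> G q x (F q x) = 1"
      "\<And>q x v. q \<in> T \<Longrightarrow> x \<in> I \<Longrightarrow> v \<in> U q x \<Longrightarrow> s (G q x v) (F q x) = v"
    by metis
  have T: "q < r" if "q \<in> T" for q using that by (simp add: T_def)
  have F_in: "F q x \<in> U q x" if "q \<in> T" "x \<in> I" for q x
    using FG(1)[OF that(1)] that IP by (auto simp: hom_from_def)
  show thesis
  \<comment> \<open>The coordinate on summand q becomes a morphism on all of M after projecting to
    that summand.\<close>
  proof (rule that[of F "\<lambda>q x v. G q x (component q x v)"])
    show "hom_from P I M (F q)" if "q \<in> T" for q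
      using hom_from_summand FG(1) T that by blast
    show "hom_to s P I M (\<lambda>x v. G q x (component q x v))" if "q \<in> T" for q
      using hom_to_component FG(2) T that by blast
    show "G p x (component p x (F q x)) = (if p = q then 1 else 0)"
      if "p \<in> T" "q \<in> T" "x \<in> I" for p q x
    proof -
      have "G p x 0 = 0"
        using poset_module.hom_to_zero[OF summand_module[OF T[OF that(1)]] FG(2)[OF that(1)]] that(3) IP
        by blast
      moreover have "component p x (F q x) = (if p = q then F q x else 0)"
        using that IP T F_in by (intro component_summand) auto
      ultimately show ?thesis using that FG(3) by simp
    qed
    show "g x (f x) = (\<Sum>q\<in>T. G q x (component q x (f x)) * g x (F q x))"
      if f: "hom_from P I M f" and g: "hom_to s P I M g" and x: "x \<in> I" for f g x
    proof -
      have xP: "x \<in> P" using x IP by blast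
      have fx: "f x \<in> vspace M x" using f xP by (simp add: hom_from_def)
      have other: "g x (component q x (f x)) = 0" if q: "q < r" "q \<notin> T" for q
      proof (rule ccontr)
        interpret Q: poset_module s P "M\<lparr>vspace := U q\<rparr>" using q summand_module by simp
        assume "g x (component q x (f x)) \<noteq> 0"
        then have "pmodule_iso s (*) P (M\<lparr>vspace := U q\<rparr>) (interval_module I)"
          using Q.iso_interval_module_if_composite_nonzero[OF ind[OF q(1)] IP con
            hom_from_component[OF f q(1)] hom_to_summand[OF g q(1)] x] by blast
        then show False using q by (simp add: T_def)
      qed
      have "g x (f x) = g x (\<Sum>q<r. component q x (f x))"
        using xP fx by (simp add: sum_component)
      also have "\<dots> = (\<Sum>q<r. g x (component q x (f x)))"
        using xP fx by (intro hom_to_sum[OF g]) (auto intro: summand_subset component_in)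
      also have "\<dots> = (\<Sum>q\<in>T. g x (component q x (f x)))"
        using other by (intro sum.mono_neutral_right) (auto simp: T_def)
      also have "\<dots> = (\<Sum>q\<in>T. G q x (component q x (f x)) * g x (F q x))"
      proof (rule sum.cong[OF refl])
        fix q assume q: "q \<in> T"
        have "F q x \<in> vspace M x" using F_in q x T xP summand_subset by blast
        then have "g x (s (G q x (component q x (f x))) (F q x)) = G q x (component q x (f x)) * g x (F q x)"
          using g xP by (simp add: hom_to_scale)
        then show "g x (component q x (f x)) = G q x (component q x (f x)) * g x (F q x)"
          using FG(4)[OF q x component_in[OF xP fx T[OF q]]] by simp
      qed
      finally show ?thesis .
    qed
  qed
qed

end

section \<open>Existence of decompositions into indecomposables\<close>

lemma sum_lessThan_add:
  fixes h :: "nat \<Rightarrow> 'a::comm_monoid_add"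
  shows "(\<Sum>i<m + n. h i) = (\<Sum>i<m. h i) + (\<Sum>i<n. h (m + i))"
  by (induction n) (simp_all add: add.assoc)

context poset_module
begin

lemma is_submodule_trans:
  "is_submodule s P M W \<Longrightarrow> is_submodule s P (M\<lparr>vspace := W\<rparr>) U \<Longrightarrow> is_submodule s P M U"
  by (auto simp: is_submodule_def dest!: bspec subsetD)

text \<open>Concatenates decompositions in the induction that follows. Independence is tested first
  between \<open>W 0\<close> and \<open>W 1\<close>, then within each of them.\<close>

lemma is_direct_sum_refine:
  assumes W: "is_direct_sum s P M 2 W"
    and U: "is_direct_sum s P (M\<lparr>vspace := W 0\<rparr>) q U"
    and U': "is_direct_sum s P (M\<lparr>vspace := W 1\<rparr>) r U'"
  shows "is_direct_sum s P M (q + r) (\<lambda>i. if i < q then U i else U' (i - q))"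
    (is "is_direct_sum s P M (q + r) ?U")
proof (rule is_direct_sumI)
  interpret W: direct_sum_decomposition s P M 2 W
    by unfold_locales (rule W)
  interpret U: direct_sum_decomposition s P "M\<lparr>vspace := W 0\<rparr>" q U
    using U W.summand_module[of 0] by (simp add: direct_sum_decomposition_def direct_sum_decomposition_axioms_def)
  interpret U': direct_sum_decomposition s P "M\<lparr>vspace := W 1\<rparr>" r U'
    using U' W.summand_module[of 1] by (simp add: direct_sum_decomposition_def direct_sum_decomposition_axioms_def)
  show "is_submodule s P M (?U i)" if i: "i < q + r" for i
    using is_submodule_trans[OF W.submodule[of 0] U.submodule[of i]]
      is_submodule_trans[OF W.submodule[of 1] U'.submodule[of "i - q"]] i
    by auto
  show "\<exists>u. (\<forall>i<q + r. u i \<in> ?U i x) \<and> v = (\<Sum>i<q + r. u i)"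
    if x: "x \<in> P" and v: "v \<in> vspace M x" for x v
  proof -
    let ?u = "\<lambda>i. if i < q then U.component i x (W.component 0 x v)
                   else U'.component (i - q) x (W.component 1 x v)"
    have W01: "W.component 0 x v \<in> W 0 x" "W.component 1 x v \<in> W 1 x"
      using W.component_in[OF x v] by simp_all
    have "(\<Sum>i<q + r. ?u i) = W.component 0 x v + W.component 1 x v"
      using U.sum_component[of x] U'.sum_component[of x] x W01 by (simp add: sum_lessThan_add)
    also have "\<dots> = v"
      using W.sum_component[OF x v] by (simp add: numeral_2_eq_2)
    finally have "v = (\<Sum>i<q + r. ?u i)" by simp
    moreover have "\<forall>i<q + r. ?u i \<in> ?U i x"
      using U.component_in[of x] U'.component_in[of x] x W01 by auto
    ultimately show ?thesis by (intro exI[of _ ?u] conjI)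
  qed
  show "u i = 0" if x: "x \<in> P" and u: "\<And>i. i < q + r \<Longrightarrow> u i \<in> ?U i x"
    and sum: "(\<Sum>i<q + r. u i) = 0" and i: "i < q + r" for x u i
  proof -
    have u0: "u j \<in> U j x" if "j < q" for j using u[of j] that by simp
    have u1: "u (q + j) \<in> U' j x" if "j < r" for j using u[of "q + j"] that by simp
    \<comment> \<open>Regroups the q + r terms into one vector of \<open>W 0\<close> and one of
      \<open>W 1\<close>, so that independence of these two applies.\<close>
    let ?w = "\<lambda>j::nat. if j = 0 then (\<Sum>j<q. u j) else (\<Sum>j<r. u (q + j))"
    have w0: "(\<Sum>j<q. u j) \<in> W 0 x"
      using x u0 U.summand_subset[of _ x] W.subspace_summand[of 0 x] by (intro V.subspace_sum) auto
    have w1: "(\<Sum>j<r. u (q + j)) \<in> W 1 x"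
      using x u1 U'.summand_subset[of _ x] W.subspace_summand[of 1 x] by (intro V.subspace_sum) auto
    have w: "?w j \<in> W j x" if "j < 2" for j
      using w0 w1 that by (auto simp: less_2_cases_iff)
    have "(\<Sum>j<2. ?w j) = 0"
      using sum by (simp add: sum_lessThan_add numeral_2_eq_2)
    from W.summands_independent[OF x w this, of 0] W.summands_independent[OF x w this, of 1]
    have "(\<Sum>j<q. u j) = 0" "(\<Sum>j<r. u (q + j)) = 0" by simp_all
    then have "j < q \<Longrightarrow> u j = 0" "j < r \<Longrightarrow> u (q + j) = 0" for j
      using U.summands_independent[OF x u0, of j] U'.summands_independent[of x "\<lambda>j. u (q + j)" j] x u1
      by simp_all
    from this(1)[of i] this(2)[of "i - q"] show "u i = 0" using i by (cases "i < q") auto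
  qed
qed

end

text \<open>Induction on the total dimension over P: when two summands are both nonzero, each is
  strictly smaller than M at a point where the other is nonzero. Existence is half of what makes the
  description in \<open>multiplicity_in\<close> denote a number; the rank formula gives the other
  half.\<close>

lemma exists_indecomposable_decomposition:
  fixes M :: "('p::order, 'v::ab_group_add) pmodule"
  assumes fin: "finite P" and "is_pmodule s P M"
  shows "\<exists>r U. is_direct_sum s P M r U \<and> (\<forall>i<r. indecomposable s P (M\<lparr>vspace := U i\<rparr>))"
  using assms(2)
proof (induction "\<Sum>x\<in>P. vector_space.dim s (vspace M x)" arbitrary: M rule: less_induct)
  case less
  interpret poset_module s P M by unfold_locales (rule less.prems)
  consider "indecomposable s P M" | "\<forall>x\<in>P. vspace M x = {0}"
    | W where "is_direct_sum s P M 2 W" "\<not> (\<forall>x\<in>P. W 0 x = {0})" "\<not> (\<forall>x\<in>P. W 1 x = {0})"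
    unfolding indecomposable_def by blast
  then show ?case
  proof cases
    case 1
    have "is_direct_sum s P M (Suc 0) (\<lambda>_. vspace M)"
    proof (rule is_direct_sumI)
      fix x v assume "v \<in> vspace M x"
      then show "\<exists>u. (\<forall>i<Suc 0. u i \<in> vspace M x) \<and> v = (\<Sum>i<Suc 0. u i)"
        by (intro exI[of _ "\<lambda>_. v"]) simp
    qed (auto simp: is_submodule_def subspace_vspace struct_map_in)
    moreover have "M\<lparr>vspace := vspace M\<rparr> = M" by simp
    ultimately show ?thesis using 1 by (intro exI[of _ "Suc 0"] exI[of _ "\<lambda>_. vspace M"]) simp
  next
    case 2
    \<comment> \<open>The zero module is not indecomposable; it is the direct sum of no
      summands.\<close>
    have "is_direct_sum s P M 0 U" for U
      by (rule is_direct_sumI) (use 2 in auto)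
    then show ?thesis by blast
  next
    case 3
    interpret W: direct_sum_decomposition s P M 2 W
      by unfold_locales (rule 3(1))
    have smaller: "\<exists>r U. is_direct_sum s P (M\<lparr>vspace := W i\<rparr>) r U \<and>
        (\<forall>j<r. indecomposable s P (M\<lparr>vspace := U j\<rparr>))"
      if i: "i < 2" and j: "j < 2" "i \<noteq> j" and nz: "\<not> (\<forall>x\<in>P. W j x = {0})" for i j
    proof -
      have sub: "W i x \<subseteq> vspace M x" if "x \<in> P" for x
        using W.submodule[OF i] that by (simp add: is_submodule_def)
      obtain x where x: "x \<in> P" "W j x \<noteq> {0}" using nz by blast
      then obtain v where v: "v \<in> W j x" "v \<noteq> 0"
        using V.subspace_0[OF W.subspace_summand[OF j(1) x(1)]] by blast
      \<comment> \<open>Otherwise the i-th component of v would be v, seen in \<open>W i\<close>,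
        and also 0, seen in \<open>W j\<close>.\<close>
      have "v \<notin> W i x"
        using W.component_summand[OF x(1) j(1) i v(1)] W.component_summand[OF x(1) i i, of v] j(2) v(2)
        by auto
      then have "W i x \<noteq> vspace M x"
        using W.summand_subset[OF j(1) x(1) v(1)] by blast
      then have "\<not> V.dim (vspace M x) \<le> V.dim (W i x)"
        using subspace_dim_eq_finitely_spanned[OF V.vector_space_axioms finitely_spanned_vspace
            W.subspace_summand sub, OF x(1) i x(1) x(1)] by blast
      moreover have "V.dim (W i y) \<le> V.dim (vspace M y)" if "y \<in> P" for y
        using dim_subset_finitely_spanned[OF V.vector_space_axioms finitely_spanned_vspace sub] that by blast
      ultimately have "(\<Sum>x\<in>P. V.dim (W i x)) < (\<Sum>x\<in>P. V.dim (vspace M x))"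
        using fin x(1) by (intro sum_strict_mono_ex1) (auto simp: not_le)
      then show ?thesis
        using less.hyps[of "M\<lparr>vspace := W i\<rparr>"] submodule_is_pmodule[OF W.submodule[OF i]] by simp
    qed
    obtain q U where U: "is_direct_sum s P (M\<lparr>vspace := W 0\<rparr>) q U"
        "\<forall>j<q. indecomposable s P (M\<lparr>vspace := U j\<rparr>)"
      using smaller[of 0 1] 3(3) by auto
    obtain r U' where U': "is_direct_sum s P (M\<lparr>vspace := W 1\<rparr>) r U'"
        "\<forall>j<r. indecomposable s P (M\<lparr>vspace := U' j\<rparr>)"
      using smaller[of 1 0] 3(2) by auto
    show ?thesis
      using is_direct_sum_refine[OF 3(1) U(1) U'(1)] U(2) U'(2)
      by (intro exI[of _ "q + r"] exI[of _ "\<lambda>i. if i < q then U i else U' (i - q)"]) auto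
  qed
qed

section \<open>Antichains in the grid\<close>

lemma sc_le_imp_eq: "x \<in> sc U \<Longrightarrow> y \<in> sc U \<Longrightarrow> x \<le> y \<Longrightarrow> x = y"
  by (auto simp: sc_def)

lemma sk_le_imp_eq: "x \<in> sk U \<Longrightarrow> y \<in> sk U \<Longrightarrow> x \<le> y \<Longrightarrow> x = y"
  by (auto simp: sk_def)

lemma exists_sc_le:
  assumes "finite U" "y \<in> U"
  shows "\<exists>x\<in>sc U. x \<le> y"
  using finite_has_minimal2[OF assms] by (fastforce simp: sc_def)

lemma exists_sk_ge:
  assumes "finite U" "y \<in> U"
  shows "\<exists>x\<in>sk U. y \<le> x"
  using finite_has_maximal2[OF assms] by (fastforce simp: sk_def)

text \<open>Common abstraction of \<open>sc I\<close> and \<open>sk I\<close>. Increasing second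
  coordinates force decreasing first coordinates, and this staircase shape is all that the arguments
  on joins and meets use.\<close>

locale enumerated_antichain =
  fixes e :: "nat \<Rightarrow> nat \<times> nat" and k :: nat
  assumes antichain: "p \<in> {1..k} \<Longrightarrow> q \<in> {1..k} \<Longrightarrow> e p \<le> e q \<Longrightarrow> e p = e q"
    and mono: "strict_mono_on {1..k} (\<lambda>q. snd (e q))"
begin

lemma snd_less: "p \<in> {1..k} \<Longrightarrow> q \<in> {1..k} \<Longrightarrow> p < q \<Longrightarrow> snd (e p) < snd (e q)"
  using mono by (rule strict_mono_onD)

lemma fst_less:
  assumes "p \<in> {1..k}" "q \<in> {1..k}" "p < q"
  shows "fst (e q) < fst (e p)"
proof (rule ccontr)
  assume "\<not> fst (e q) < fst (e p)"
  then have "e p \<le> e q"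
    using snd_less[OF assms] by (simp add: less_eq_prod_def)
  then show False
    using antichain assms snd_less[OF assms] by fastforce
qed

lemma sup_Suc: "1 \<le> t \<Longrightarrow> Suc t \<le> k \<Longrightarrow> sup (e t) (e (Suc t)) = (fst (e t), snd (e (Suc t)))"
  using snd_less[of t "Suc t"] fst_less[of t "Suc t"] by (simp add: sup_prod_def sup_nat_def)

lemma inf_Suc: "1 \<le> t \<Longrightarrow> Suc t \<le> k \<Longrightarrow> inf (e t) (e (Suc t)) = (fst (e (Suc t)), snd (e t))"
  using snd_less[of t "Suc t"] fst_less[of t "Suc t"] by (simp add: inf_prod_def inf_nat_def)

lemma inj: "p \<in> {1..k} \<Longrightarrow> q \<in> {1..k} \<Longrightarrow> e p = e q \<longleftrightarrow> p = q"
  by (metis less_irrefl linorder_neqE_nat snd_less)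

text \<open>Rows of \<open>M1\<close> are indexed by grid points rather than by numbers, so joins of
  different neighbouring pairs must not merge into one row. The second coordinate of the join
  recovers the index.\<close>

lemma sup_Suc_inj:
  assumes "1 \<le> t" "Suc t \<le> k" "1 \<le> u" "Suc u \<le> k" "sup (e t) (e (Suc t)) = sup (e u) (e (Suc u))"
  shows "t = u"
  using assms snd_less[of "Suc t" "Suc u"] snd_less[of "Suc u" "Suc t"]
  by (cases t u rule: linorder_cases) (auto simp: sup_Suc)

lemma inf_Suc_inj:
  assumes "1 \<le> t" "Suc t \<le> k" "1 \<le> u" "Suc u \<le> k" "inf (e t) (e (Suc t)) = inf (e u) (e (Suc u))"
  shows "t = u"
  using assms snd_less[of t u] snd_less[of u t]
  by (cases t u rule: linorder_cases) (auto simp: inf_Suc)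

text \<open>Both coordinates are monotone along the staircase, in opposite directions: a bound on
  the first coordinate is inherited from one end of a run and a bound on the second from the other
  end.\<close>

lemma between:
  assumes "p \<in> {1..k}" "q \<in> {1..k}" "p \<le> t" "t \<le> q"
  shows "e p \<le> x \<Longrightarrow> e q \<le> x \<Longrightarrow> e t \<le> x"
    and "x \<le> e p \<Longrightarrow> x \<le> e q \<Longrightarrow> x \<le> e t"
proof -
  have "fst (e t) \<le> fst (e p)" "snd (e t) \<le> snd (e q)" "fst (e q) \<le> fst (e t)" "snd (e p) \<le> snd (e t)"
    using assms fst_less[of p t] snd_less[of t q] fst_less[of t q] snd_less[of p t]
    by (cases "p = t"; cases "t = q"; force)+
  then show "e p \<le> x \<Longrightarrow> e q \<le> x \<Longrightarrow> e t \<le> x" "x \<le> e p \<Longrightarrow> x \<le> e q \<Longrightarrow> x \<le> e t"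
    by (auto simp: less_eq_prod_def)
qed

text \<open>In both uses Q t says that e t lies below, or above, a fixed point x. Relations between
  neighbours then propagate along the run of such t and make the transported value independent of
  the chosen member.\<close>

lemma chain_eq:
  assumes step: "\<And>t. 1 \<le> t \<Longrightarrow> Suc t \<le> k \<Longrightarrow> Q t \<Longrightarrow> Q (Suc t) \<Longrightarrow> h t = h (Suc t)"
    and mid: "\<And>p q t. p \<in> {1..k} \<Longrightarrow> q \<in> {1..k} \<Longrightarrow> p \<le> t \<Longrightarrow> t \<le> q \<Longrightarrow> Q p \<Longrightarrow> Q q \<Longrightarrow> Q t"
    and pq: "p \<in> {1..k}" "q \<in> {1..k}" "Q p" "Q q"
  shows "h p = h q"
proof -
  have *: "h p = h q" if "p \<in> {1..k}" "q \<in> {1..k}" "Q p" "Q q" "p \<le> q" for p q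
  proof -
    have "h p = h t" if "p \<le> t" "t \<le> q" for t
      using that
    proof (induction t rule: dec_induct)
      case (step t)
      have "Q t" "Q (Suc t)"
        using mid[of p q] step \<open>p \<in> {1..k}\<close> \<open>q \<in> {1..k}\<close> \<open>Q p\<close> \<open>Q q\<close> by auto
      then have "h t = h (Suc t)"
        using assms(1)[of t] step \<open>p \<in> {1..k}\<close> \<open>q \<in> {1..k}\<close> by auto
      then show ?case using step by simp
    qed simp
    then show ?thesis using \<open>p \<le> q\<close> by simp
  qed
  show ?thesis
    using *[OF pq] *[OF pq(2,1,4,3)] by (metis nat_le_linear)
qed

end

lemma finite_grid: "finite (grid m n)"
  by (simp add: grid_def)

lemma sup_in_grid: "x \<in> grid m n \<Longrightarrow> y \<in> grid m n \<Longrightarrow> sup x y \<in> grid m n"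
  by (auto simp: grid_def sup_prod_def sup_nat_def max_def)

lemma inf_in_grid: "x \<in> grid m n \<Longrightarrow> y \<in> grid m n \<Longrightarrow> inf x y \<in> grid m n"
  by (auto simp: grid_def inf_prod_def inf_nat_def min_def)

section \<open>Morphisms in terms of the minimal and maximal elements\<close>

locale grid_interval = poset_module s P M
  for s :: "'k::field \<Rightarrow> 'v::ab_group_add \<Rightarrow> 'v" and P :: "(nat \<times> nat) set"
    and M :: "(nat \<times> nat, 'v) pmodule" +
  fixes m n k l :: nat and I :: "(nat \<times> nat) set"
    and a b :: "nat \<Rightarrow> nat \<times> nat" and c d :: "nat \<times> nat \<Rightarrow> nat \<times> nat"
  assumes P_grid: "P = grid m n" and I_sub: "I \<subseteq> P"
    and sc_a: "sc I = a ` {1..k}" and mono_a: "strict_mono_on {1..k} (\<lambda>q. snd (a q))"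
    and sk_b: "sk I = b ` {1..l}" and mono_b: "strict_mono_on {1..l} (\<lambda>q. snd (b q))"
    and c: "up_choice P I c" and d: "down_choice P I d"
begin

sublocale a: enumerated_antichain a k
proof
  show "a p = a q" if "p \<in> {1..k}" "q \<in> {1..k}" "a p \<le> a q" for p q
    using sc_le_imp_eq[of "a p" I "a q"] sc_a that by blast
qed (rule mono_a)

sublocale b: enumerated_antichain b l
proof
  show "b p = b q" if "p \<in> {1..l}" "q \<in> {1..l}" "b p \<le> b q" for p q
    using sk_le_imp_eq[of "b p" I "b q"] sk_b that by blast
qed (rule mono_b)

lemma finite_P: "finite P"
  by (simp add: P_grid finite_grid)

lemma sc_sub: "x \<in> sc I \<Longrightarrow> x \<in> I"
  by (simp add: sc_def)

lemma sk_sub: "x \<in> sk I \<Longrightarrow> x \<in> I"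
  by (simp add: sk_def)

lemma a_in: "t \<in> {1..k} \<Longrightarrow> a t \<in> sc I" "t \<in> {1..k} \<Longrightarrow> a t \<in> I" "t \<in> {1..k} \<Longrightarrow> a t \<in> P"
  using sc_a sc_sub I_sub by blast+

lemma b_in: "t \<in> {1..l} \<Longrightarrow> b t \<in> sk I" "t \<in> {1..l} \<Longrightarrow> b t \<in> I" "t \<in> {1..l} \<Longrightarrow> b t \<in> P"
  using sk_b sk_sub I_sub by blast+

lemma a_sup_in: "1 \<le> t \<Longrightarrow> Suc t \<le> k \<Longrightarrow> sup (a t) (a (Suc t)) \<in> P"
  using a_in(3)[of t] a_in(3)[of "Suc t"] by (simp add: P_grid sup_in_grid)

lemma b_inf_in: "1 \<le> t \<Longrightarrow> Suc t \<le> l \<Longrightarrow> inf (b t) (b (Suc t)) \<in> P"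
  using b_in(3)[of t] b_in(3)[of "Suc t"] by (simp add: P_grid inf_in_grid)

lemma sc_strict_up: "x \<in> sc (strict_up_set P I) \<Longrightarrow> x \<in> P \<and> x \<notin> I \<and> c x \<in> sc I \<and> c x \<le> x"
  using c by (simp add: up_choice_def) (simp add: sc_def strict_up_set_def up_set_def)

lemma sk_strict_down: "x \<in> sk (strict_down_set P I) \<Longrightarrow> x \<in> P \<and> x \<notin> I \<and> d x \<in> sk I \<and> x \<le> d x"
  using d by (simp add: down_choice_def) (simp add: sk_def strict_down_set_def down_set_def)

lemma exists_a_le: "x \<in> I \<Longrightarrow> \<exists>y\<in>sc I. y \<le> x"
  using exists_sc_le[of I x] finite_subset[OF I_sub finite_P] by blast

lemma exists_b_ge: "x \<in> I \<Longrightarrow> \<exists>y\<in>sk I. x \<le> y"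
  using exists_sk_ge[of I x] finite_subset[OF I_sub finite_P] by blast

text \<open>This is the presentation of V_I: minimal elements of I generate, neighbours are
  identified at their joins, and a generator is killed at each minimal point of the strict up-set.
  The value at x is transported from any minimal element below x; the choice is immaterial because
  those elements form a run, and joins of neighbours in the run still lie below x.\<close>

lemma hom_from_extend:
  assumes v: "\<And>x. x \<in> sc I \<Longrightarrow> v x \<in> vspace M x"
    and rel: "\<And>t. 1 \<le> t \<Longrightarrow> Suc t \<le> k \<Longrightarrow>
        struct_map M (sup (a t) (a (Suc t))) (a t) (v (a t))
        = struct_map M (sup (a t) (a (Suc t))) (a (Suc t)) (v (a (Suc t)))"
    and van: "\<And>x. x \<in> sc (strict_up_set P I) \<Longrightarrow> struct_map M x (c x) (v (c x)) = 0"
  obtains f where "hom_from P I M f" "\<And>x. x \<in> sc I \<Longrightarrow> f x = v x"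
proof -
  \<comment> \<open>Stated for all points of P, because it is also needed outside I, where it
    replaces z by \<open>c x'\<close>.\<close>
  have agree: "struct_map M x y (v y) = struct_map M x z (v z)"
    if x: "x \<in> P" and y: "y \<in> sc I" "y \<le> x" and z: "z \<in> sc I" "z \<le> x" for x y z
  proof -
    obtain p q where pq: "p \<in> {1..k}" "y = a p" "q \<in> {1..k}" "z = a q"
      using y z sc_a by auto
    have "struct_map M x (a p) (v (a p)) = struct_map M x (a q) (v (a q))"
    proof (rule a.chain_eq[where Q = "\<lambda>t. a t \<le> x" and h = "\<lambda>t. struct_map M x (a t) (v (a t))"])
      fix t assume t: "1 \<le> t" "Suc t \<le> k" "a t \<le> x" "a (Suc t) \<le> x"
      let ?y = "sup (a t) (a (Suc t))"
      have "struct_map M x ?y (struct_map M ?y (a t) (v (a t))) = struct_map M x (a t) (v (a t))"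
           "struct_map M x ?y (struct_map M ?y (a (Suc t)) (v (a (Suc t)))) = struct_map M x (a (Suc t)) (v (a (Suc t)))"
        using t x a_in[of t] a_in[of "Suc t"] a_sup_in[of t] v by (simp_all add: struct_map_comp)
      then show "struct_map M x (a t) (v (a t)) = struct_map M x (a (Suc t)) (v (a (Suc t)))"
        using rel[OF t(1,2)] by simp
    qed (use pq y z a.between(1) in auto)
    then show ?thesis using pq by simp
  qed
  define f where "f = (\<lambda>x. if x \<in> I then struct_map M x (SOME y. y \<in> sc I \<and> y \<le> x)
      (v (SOME y. y \<in> sc I \<and> y \<le> x)) else 0)"
  have f_eq: "f x = struct_map M x y (v y)" if x: "x \<in> I" and y: "y \<in> sc I" "y \<le> x" for x y
  proof -
    have "(SOME y. y \<in> sc I \<and> y \<le> x) \<in> sc I \<and> (SOME y. y \<in> sc I \<and> y \<le> x) \<le> x"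
      using someI[of "\<lambda>y. y \<in> sc I \<and> y \<le> x" y] y by blast
    then show ?thesis
      using agree[of x "SOME y. y \<in> sc I \<and> y \<le> x" y] x y I_sub by (auto simp: f_def)
  qed
  have f_in: "f x \<in> vspace M x" if x: "x \<in> P" for x
  proof (cases "x \<in> I")
    case True
    then obtain y where y: "y \<in> sc I" "y \<le> x" using exists_a_le by blast
    then show ?thesis
      using f_eq[OF True y] v[OF y(1)] sc_sub[OF y(1)] I_sub x by (auto simp: struct_map_in)
  next
    case False
    then show ?thesis using x by (simp add: f_def zero_in_vspace)
  qed
  have "hom_from P I M f"
    unfolding hom_from_def
  proof (intro conjI ballI impI)
    fix x y assume x: "x \<in> P \<inter> I" and y: "y \<in> P" and xy: "x \<le> y"
    obtain z where z: "z \<in> sc I" "z \<le> x" using exists_a_le x by blast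
    have zP: "z \<in> P" using z sc_sub I_sub by blast
    have fx: "struct_map M y x (f x) = struct_map M y z (v z)"
      using f_eq[of x z] x y xy z zP v by (simp add: struct_map_comp)
    show "struct_map M y x (f x) = f y"
    proof (cases "y \<in> I")
      case True
      then show ?thesis using fx f_eq[of y z] z xy by simp
    next
      case False
      \<comment> \<open>When the arrow leaves I, it can be compared with one through a minimal point
        x' of the strict up-set, where the chosen generator has already become 0.\<close>
      then have "y \<in> strict_up_set P I"
        using x y xy by (auto simp: strict_up_set_def up_set_def)
      moreover have "finite (strict_up_set P I)"
        using finite_P by (auto simp: strict_up_set_def up_set_def)
      ultimately obtain x' where x': "x' \<in> sc (strict_up_set P I)" "x' \<le> y"
        using exists_sc_le by blast
      note cx = sc_strict_up[OF x'(1)]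
      have cP: "c x' \<in> P" using cx sc_sub I_sub by blast
      have "struct_map M y z (v z) = struct_map M y (c x') (v (c x'))"
        using agree[OF y, of z "c x'"] z xy cx x'(2) by (meson order_trans)
      also have "\<dots> = struct_map M y x' (struct_map M x' (c x') (v (c x')))"
        using cx x'(2) y cP v by (simp add: struct_map_comp)
      also have "\<dots> = 0"
        using van[OF x'(1)] cx y x'(2) by (simp add: struct_map_zero)
      finally show ?thesis using fx False by (simp add: f_def)
    qed
  qed (use f_in in \<open>simp_all add: f_def\<close>)
  moreover have "f x = v x" if "x \<in> sc I" for x
    using f_eq[of x x] that sc_sub[OF that] I_sub v[OF that] by (auto simp: struct_map_refl)
  ultimately show thesis by (rule that)
qed

text \<open>Dual of \<open>hom_from_extend\<close>: linear forms at the maximal elements are pulled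
  back instead of vectors being pushed forward, so each relation has to hold for every vector at the
  meet or at the maximal point of the strict down-set.\<close>

lemma hom_to_extend:
  assumes \<phi>: "\<And>y. y \<in> sk I \<Longrightarrow> linear_map_on s (*) (vspace M y) UNIV (\<phi> y)"
    and rel: "\<And>t v. 1 \<le> t \<Longrightarrow> Suc t \<le> l \<Longrightarrow> v \<in> vspace M (inf (b t) (b (Suc t))) \<Longrightarrow>
        \<phi> (b t) (struct_map M (b t) (inf (b t) (b (Suc t))) v)
        = \<phi> (b (Suc t)) (struct_map M (b (Suc t)) (inf (b t) (b (Suc t))) v)"
    and van: "\<And>x v. x \<in> sk (strict_down_set P I) \<Longrightarrow> v \<in> vspace M x \<Longrightarrow>
        \<phi> (d x) (struct_map M (d x) x v) = 0"
  obtains g where "hom_to s P I M g" "\<And>y v. y \<in> sk I \<Longrightarrow> v \<in> vspace M y \<Longrightarrow> g y v = \<phi> y v"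
proof -
  have agree: "\<phi> y (struct_map M y x v) = \<phi> z (struct_map M z x v)"
    if x: "x \<in> P" "v \<in> vspace M x" and y: "y \<in> sk I" "x \<le> y" and z: "z \<in> sk I" "x \<le> z" for x y z v
  proof -
    obtain p q where pq: "p \<in> {1..l}" "y = b p" "q \<in> {1..l}" "z = b q"
      using y z sk_b by auto
    have "\<phi> (b p) (struct_map M (b p) x v) = \<phi> (b q) (struct_map M (b q) x v)"
    proof (rule b.chain_eq[where Q = "\<lambda>t. x \<le> b t" and h = "\<lambda>t. \<phi> (b t) (struct_map M (b t) x v)"])
      fix t assume t: "1 \<le> t" "Suc t \<le> l" "x \<le> b t" "x \<le> b (Suc t)"
      let ?y = "inf (b t) (b (Suc t))"
      have "struct_map M (b t) ?y (struct_map M ?y x v) = struct_map M (b t) x v"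
           "struct_map M (b (Suc t)) ?y (struct_map M ?y x v) = struct_map M (b (Suc t)) x v"
        using t x b_in[of t] b_in[of "Suc t"] b_inf_in[of t] by (simp_all add: struct_map_comp)
      then show "\<phi> (b t) (struct_map M (b t) x v) = \<phi> (b (Suc t)) (struct_map M (b (Suc t)) x v)"
        using rel[OF t(1,2), of "struct_map M ?y x v"] t x b_inf_in[of t] by (simp add: struct_map_in)
    qed (use pq y z b.between(2) in auto)
    then show ?thesis using pq by simp
  qed
  define up where "up = (\<lambda>x. SOME y. y \<in> sk I \<and> x \<le> y)"
  have up: "up x \<in> sk I" "x \<le> up x" "up x \<in> P" if "x \<in> I" for x
    using someI_ex[of "\<lambda>y. y \<in> sk I \<and> x \<le> y"] exists_b_ge[OF that] sk_sub I_sub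
    unfolding up_def by blast+
  define g where "g = (\<lambda>x v. if x \<in> I then \<phi> (up x) (struct_map M (up x) x v) else 0)"
  have g_eq: "g x v = \<phi> y (struct_map M y x v)"
    if x: "x \<in> I" and y: "y \<in> sk I" "x \<le> y" and v: "v \<in> vspace M x" for x y v
    using agree[of x v "up x" y] x y v up[of x] I_sub by (auto simp: g_def)
  have "hom_to s P I M g"
    unfolding hom_to_def
  proof (intro conjI ballI impI)
    fix x assume x: "x \<in> P"
    show "linear_map_on s (*) (vspace M x) UNIV (g x)"
    proof (cases "x \<in> I")
      case True
      then show ?thesis
        using \<phi>[OF up(1)[OF True]] up(2,3)[OF True] x
        by (auto simp: g_def linear_map_on_def struct_map_add struct_map_scale struct_map_in)
    qed (auto simp: g_def linear_map_on_def)
  next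
    fix x y v assume x: "x \<in> P" and y: "y \<in> P \<inter> I" and xy: "x \<le> y" and v: "v \<in> vspace M x"
    obtain z where z: "z \<in> sk I" "y \<le> z" using exists_b_ge y by blast
    have zP: "z \<in> P" using z sk_sub I_sub by blast
    have gy: "g y (struct_map M y x v) = \<phi> z (struct_map M z x v)"
      using g_eq[of y z "struct_map M y x v"] x y xy z zP v by (simp add: struct_map_comp struct_map_in)
    show "g y (struct_map M y x v) = g x v"
    proof (cases "x \<in> I")
      case True
      then show ?thesis using gy g_eq[of x z v] z xy v by simp
    next
      case False
      then have "x \<in> strict_down_set P I"
        using x y xy by (auto simp: strict_down_set_def down_set_def)
      moreover have "finite (strict_down_set P I)"
        using finite_P by (auto simp: strict_down_set_def down_set_def)
      ultimately obtain x' where x': "x' \<in> sk (strict_down_set P I)" "x \<le> x'"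
        using exists_sk_ge by blast
      note dx = sk_strict_down[OF x'(1)]
      have dP: "d x' \<in> P" using dx sk_sub I_sub by blast
      have "\<phi> z (struct_map M z x v) = \<phi> (d x') (struct_map M (d x') x v)"
        using agree[OF x v, of z "d x'"] z xy dx x'(2) by (meson order_trans)
      also have "\<dots> = \<phi> (d x') (struct_map M (d x') x' (struct_map M x' x v))"
        using dx x'(2) x dP v by (simp add: struct_map_comp)
      also have "\<dots> = 0"
        using van[OF x'(1)] dx x x'(2) v by (simp add: struct_map_in)
      finally show ?thesis using gy False by (simp add: g_def)
    qed
  qed (simp add: g_def)
  moreover have "g y v = \<phi> y v" if "y \<in> sk I" "v \<in> vspace M y" for y v
    using g_eq[of y y v] that sk_sub[OF that(1)] I_sub by (auto simp: struct_map_refl)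
  ultimately show thesis by (rule that)
qed

end

section \<open>Spaces of families and block matrices\<close>

definition single :: "'i \<Rightarrow> 'v::zero \<Rightarrow> 'i \<Rightarrow> 'v" where
  "single i v = (\<lambda>r. if r = i then v else 0)"

lemma sum_apply: "(\<Sum>i\<in>A. f i) x = (\<Sum>i\<in>A. f i x)"
  by (induction A rule: infinite_finite_induct) simp_all

lemma sum_two_indices:
  fixes f g :: "'x \<Rightarrow> 'y::comm_monoid_add"
  assumes "finite A" "p \<in> A" "q \<in> A" "p \<noteq> q"
  shows "(\<Sum>x\<in>A. if x = p then f x else if x = q then g x else 0) = f p + g q"
proof -
  have "(\<Sum>x\<in>A. if x = p then f x else if x = q then g x else 0) =
      (\<Sum>x\<in>A. (if x = p then f x else 0) + (if x = q then g x else 0))"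
    using assms(4) by (intro sum.cong) auto
  also have "\<dots> = f p + g q" using assms by (simp add: sum.distrib)
  finally show ?thesis .
qed

lemma vector_space_pointwise:
  assumes "vector_space s"
  shows "vector_space (\<lambda>r f i. s r (f i))"
proof -
  interpret V: vector_space s by fact
  show ?thesis
    by unfold_locales (auto simp: fun_eq_iff V.scale_right_distrib V.scale_left_distrib)
qed

lemma linear_single:
  assumes "vector_space s"
  shows "Vector_Spaces.linear s (\<lambda>r f i. s r (f i)) (single i)"
proof -
  interpret V: vector_space s by fact
  show ?thesis
    unfolding Vector_Spaces.linear_iff using assms vector_space_pointwise[OF assms]
    by (auto simp: single_def fun_eq_iff)
qed

text \<open>A block matrix acts linearly only on the direct sum of the module's spaces, so images
  have to be handled for maps that are linear just on a subspace.\<close>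

lemma linear_map_on_image:
  assumes s: "vector_space s" and t: "vector_space t" and h: "linear_map_on s t V W h"
    and V: "module.subspace s V" "finitely_spanned s V"
  shows "module.subspace t (h ` V)" and "finitely_spanned t (h ` V)"
proof -
  interpret S: vector_space s by fact
  interpret T: vector_space t by fact
  have add: "h (u + v) = h u + h v" and scale: "h (s r v) = t r (h v)" if "u \<in> V" "v \<in> V" for r u v
    using h that by (auto simp: linear_map_on_def)
  have zero: "h 0 = 0"
    using scale[of 0 0 0] S.subspace_0[OF V(1)] by simp
  show "T.subspace (h ` V)"
  proof (rule T.subspaceI)
    show "0 \<in> h ` V" using zero S.subspace_0[OF V(1)] by (metis imageI)
    show "x + y \<in> h ` V" if "x \<in> h ` V" "y \<in> h ` V" for x y
      using that S.subspace_add[OF V(1)] by (auto simp flip: add)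
    show "t r x \<in> h ` V" if "x \<in> h ` V" for x r
      using that S.subspace_scale[OF V(1)] by (auto simp flip: scale)
  qed
  obtain B where B: "B \<subseteq> V" "S.independent B" "V \<subseteq> S.span B" "card B = S.dim V"
    by (rule S.basis_exists)
  have "finite B"
    using finite_independent_subset[OF s V(2)] B by blast
  \<comment> \<open>Membership in V travels through the span induction, since h is known to be
    additive only there.\<close>
  have "x \<in> V \<and> h x \<in> T.span (h ` B)" if "x \<in> S.span B" for x
    using that
  proof (induction rule: S.span_induct_alt)
    case base
    then show ?case using zero S.subspace_0[OF V(1)] T.span_zero by simp
  next
    case (step r x y)
    have x: "x \<in> V" using step B(1) by blast
    have "h (s r x + y) = t r (h x) + h y"
      using x step S.subspace_scale[OF V(1) x] by (simp add: add scale)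
    moreover have "t r (h x) \<in> T.span (h ` B)"
      using step by (intro T.span_scale T.span_base) blast
    ultimately show ?case
      using step x S.subspace_scale[OF V(1) x] S.subspace_add[OF V(1)] T.span_add by metis
  qed
  then have "h ` V \<subseteq> T.span (h ` B)" using B(3) by blast
  then show "finitely_spanned t (h ` V)"
    using \<open>finite B\<close> unfolding finitely_spanned_def by (meson finite_imageI)
qed

lemma direct_sum_space_subspace:
  assumes s: "vector_space s" and S: "\<And>x. x \<in> C \<Longrightarrow> module.subspace s (S x)"
  shows "module.subspace (\<lambda>r f i. s r (f i)) (direct_sum_space C S)"
proof -
  interpret V: vector_space s by fact
  interpret F: vector_space "\<lambda>r f i. s r (f i)" by (rule vector_space_pointwise[OF s])
  show ?thesis
    using S by (intro F.subspaceI)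
      (auto simp: direct_sum_space_def V.subspace_0 V.subspace_add V.subspace_scale)
qed

lemma direct_sum_space_finitely_spanned:
  assumes s: "vector_space s" and C: "finite C" and S: "\<And>x. x \<in> C \<Longrightarrow> finitely_spanned s (S x)"
  shows "finitely_spanned (\<lambda>r f i. s r (f i)) (direct_sum_space C S)"
proof -
  interpret V: vector_space s by fact
  interpret F: vector_space "\<lambda>r f i. s r (f i)" by (rule vector_space_pointwise[OF s])
  interpret VF: vector_space_pair s "\<lambda>r f i. s r (f i)" ..
  obtain B where B: "\<And>x. x \<in> C \<Longrightarrow> finite (B x)" "\<And>x. x \<in> C \<Longrightarrow> S x \<subseteq> V.span (B x)"
    using S unfolding finitely_spanned_def by metis
  let ?E = "\<Union>x\<in>C. single x ` B x"
  have "f \<in> F.span ?E" if f: "f \<in> direct_sum_space C S" for f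
  proof -
    have "single x (f x) \<in> F.span ?E" if x: "x \<in> C" for x
    proof -
      have "f x \<in> V.span (B x)" using f x B(2) by (auto simp: direct_sum_space_def)
      then have "single x (f x) \<in> F.span (single x ` B x)"
        by (simp add: VF.linear_span_image[OF linear_single[OF s]])
      moreover have "F.span (single x ` B x) \<subseteq> F.span ?E"
        using x by (intro F.span_mono) blast
      ultimately show ?thesis by blast
    qed
    then have "(\<Sum>x\<in>C. single x (f x)) \<in> F.span ?E" by (rule F.span_sum)
    moreover have "(\<Sum>x\<in>C. single x (f x)) = f"
      using f C by (auto simp: fun_eq_iff sum_apply single_def direct_sum_space_def)
    ultimately show ?thesis by simp
  qed
  then show ?thesis
    using B(1) C unfolding finitely_spanned_def by (intro exI[of _ ?E]) auto
qed

lemma linear_map_on_block_apply: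
  assumes s: "vector_space s"
    and A: "\<And>r x. r \<in> R \<Longrightarrow> x \<in> C \<Longrightarrow> linear_map_on s s (S x) UNIV (A r x)"
  shows "linear_map_on (\<lambda>r f i. s r (f i)) (\<lambda>r f i. s r (f i)) (direct_sum_space C S) UNIV (block_apply R C A)"
proof -
  interpret V: vector_space s by fact
  have "A r x (u + v) = A r x u + A r x v" "A r x (s t v) = s t (A r x v)"
    if "r \<in> R" "x \<in> C" "u \<in> S x" "v \<in> S x" for r x u v t
    using A[OF that(1,2)] that(3,4) by (auto simp: linear_map_on_def)
  then show ?thesis
    unfolding linear_map_on_def
    by (auto simp: block_apply_def direct_sum_space_def fun_eq_iff sum.distrib V.scale_sum_right
        intro!: sum.cong)
qed

section \<open>The rank formula\<close>

locale grid_interval_pair = grid_interval s P M m n k l I a b c d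
  for s :: "'k::field \<Rightarrow> 'v::ab_group_add \<Rightarrow> 'v" and P :: "(nat \<times> nat) set"
    and M :: "(nat \<times> nat, 'v) pmodule" and m n k l I a b c d +
  fixes i j :: nat
  assumes i: "i \<in> {1..k}" and j: "j \<in> {1..l}" and le: "a i \<le> b j"
begin

section \<open>The block matrix with variable lower left corner\<close>

definition "row_ix = sc1 k a <+> sc (strict_up_set P I) <+> sk I"
definition "col_ix = sc I <+> sk (strict_down_set P I) <+> sk1 l b"
definition "summands = case_sum (vspace M) (case_sum (vspace M) (vspace M))"
text \<open>Both matrices of the formula are instances, with \<open>corner\<close> or
  \<open>zero_block\<close> for N, so the row computations are shared.\<close>

definition "full_matrix N = block_column
    (block_row (block1 M k a) zero_block zero_block)
    (block_row (block2 M c) zero_block zero_block)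
    (block_row N (block4 M d) (block5 M l b))"
abbreviation "corner \<equiv> block3 M (b j) (a i)"
definition "col_space = direct_sum_space col_ix summands"
definition "apply_full N = block_apply row_ix col_ix (full_matrix N)"
abbreviation "sf \<equiv> \<lambda>r f i. s r (f i)"

lemma finite_index_sets:
  "finite (sc I)" "finite (sk I)" "finite (sc (strict_up_set P I))" "finite (sk (strict_down_set P I))"
  "finite (sc1 k a)" "finite (sk1 l b)"
proof -
  have "finite I" using I_sub finite_P by (rule finite_subset)
  then show "finite (sc I)" "finite (sk I)" by (simp_all add: sc_def sk_def)
  show "finite (sc (strict_up_set P I))" "finite (sk (strict_down_set P I))"
    using finite_P by (simp_all add: sc_def sk_def strict_up_set_def strict_down_set_def up_set_def down_set_def)
  have "sc1 k a \<subseteq> P" "sk1 l b \<subseteq> P"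
    using a_sup_in b_inf_in by (auto simp: sc1_def sk1_def)
  then show "finite (sc1 k a)" "finite (sk1 l b)" using finite_P finite_subset by blast+
qed

lemma index_in_P:
  "x \<in> sc I \<Longrightarrow> x \<in> P" "x \<in> sk I \<Longrightarrow> x \<in> P" "x \<in> sk (strict_down_set P I) \<Longrightarrow> x \<in> P"
  "x \<in> sk1 l b \<Longrightarrow> x \<in> P"
  using sc_sub sk_sub I_sub sk_strict_down b_inf_in unfolding sk1_def Suc_eq_plus1 by blast+

text \<open>The search over indices in \<open>block1\<close> collapses, because a join of neighbours
  determines its position in the list.\<close>

lemma block1_eq:
  assumes t: "1 \<le> t" "Suc t \<le> k"
  shows "block1 M k a (sup (a t) (a (Suc t))) x v =
    (if x = a t then struct_map M (sup (a t) (a (Suc t))) x v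
     else if x = a (Suc t) then - struct_map M (sup (a t) (a (Suc t))) x v else 0)"
proof -
  have "(\<exists>u. 1 \<le> u \<and> u + 1 \<le> k \<and> sup (a t) (a (Suc t)) = sup (a u) (a (u + 1)) \<and> Q u) \<longleftrightarrow> Q t" for Q
    using a.sup_Suc_inj[OF t] t by (metis Suc_eq_plus1)
  then show ?thesis unfolding block1_def by simp
qed

lemma block5_eq:
  assumes t: "1 \<le> t" "Suc t \<le> l"
  shows "block5 M l b y (inf (b t) (b (Suc t))) v =
    (if y = b t then struct_map M y (inf (b t) (b (Suc t))) v
     else if y = b (Suc t) then - struct_map M y (inf (b t) (b (Suc t))) v else 0)"
proof -
  have "(\<exists>u. 1 \<le> u \<and> u + 1 \<le> l \<and> inf (b t) (b (Suc t)) = inf (b u) (b (u + 1)) \<and> Q u) \<longleftrightarrow> Q t" for Q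
    using b.inf_Suc_inj[OF t] t by (metis Suc_eq_plus1)
  then show ?thesis unfolding block5_def by simp
qed

lemma linear_struct_map_UNIV:
  "x \<in> P \<Longrightarrow> y \<in> P \<Longrightarrow> x \<le> y \<Longrightarrow> linear_map_on s s (vspace M x) UNIV (struct_map M y x)"
  using struct_map_linear[of x y] by (simp add: linear_map_on_def)

lemma linear_neg_struct_map_UNIV:
  "x \<in> P \<Longrightarrow> y \<in> P \<Longrightarrow> x \<le> y \<Longrightarrow> linear_map_on s s (vspace M x) UNIV (\<lambda>v. - struct_map M y x v)"
  using struct_map_linear[of x y] by (simp add: linear_map_on_def)

lemma linear_zero_map: "linear_map_on s s (vspace M x) UNIV (\<lambda>v. 0)"
  by (simp add: linear_map_on_def)

lemma linear_block1: "y \<in> sc1 k a \<Longrightarrow> linear_map_on s s (vspace M x) UNIV (block1 M k a y x)"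
proof -
  assume "y \<in> sc1 k a"
  then obtain t where t: "1 \<le> t" "Suc t \<le> k" and y: "y = sup (a t) (a (Suc t))"
    by (auto simp: sc1_def)
  have "a t \<in> P" "a (Suc t) \<in> P" "y \<in> P" "a t \<le> y" "a (Suc t) \<le> y"
    using a_in[of t] a_in[of "Suc t"] a_sup_in[OF t] t y by auto
  then show ?thesis
    using linear_struct_map_UNIV[of "a t" y] linear_neg_struct_map_UNIV[of "a (Suc t)" y]
      linear_zero_map[of x] block1_eq[OF t, abs_def] y
    by (cases "x = a t"; cases "x = a (Suc t)") simp_all
qed

lemma linear_block5: "x \<in> sk1 l b \<Longrightarrow> linear_map_on s s (vspace M x) UNIV (block5 M l b y x)"
proof -
  assume "x \<in> sk1 l b"
  then obtain t where t: "1 \<le> t" "Suc t \<le> l" and x: "x = inf (b t) (b (Suc t))"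
    by (auto simp: sk1_def)
  have "b t \<in> P" "b (Suc t) \<in> P" "x \<in> P" "x \<le> b t" "x \<le> b (Suc t)"
    using b_in[of t] b_in[of "Suc t"] b_inf_in[OF t] t x by auto
  then show ?thesis
    using linear_struct_map_UNIV[of x "b t"] linear_neg_struct_map_UNIV[of x "b (Suc t)"]
      linear_zero_map[of x] block5_eq[OF t, abs_def] x
    by (cases "y = b t"; cases "y = b (Suc t)") simp_all
qed

lemma linear_block2:
  "y \<in> sc (strict_up_set P I) \<Longrightarrow> linear_map_on s s (vspace M x) UNIV (block2 M c y x)"
  using linear_struct_map_UNIV[of "c y" y] linear_zero_map[of x] sc_strict_up[of y] index_in_P(1)[of "c y"]
  by (cases "x = c y") (simp_all add: block2_def)

lemma linear_block4:
  "x \<in> sk (strict_down_set P I) \<Longrightarrow> linear_map_on s s (vspace M x) UNIV (block4 M d y x)"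
  using linear_struct_map_UNIV[of x "d x"] linear_zero_map[of x] sk_strict_down[of x] index_in_P(2)[of "d x"]
  by (cases "y = d x") (simp_all add: block4_def)

lemma linear_corner: "linear_map_on s s (vspace M x) UNIV (corner y x)"
  using linear_struct_map_UNIV[OF a_in(3)[OF i] b_in(3)[OF j] le] linear_zero_map[of x]
  by (cases "y = b j"; cases "x = a i") (simp_all add: block3_def)

lemma linear_apply_full:
  assumes "\<And>x y. linear_map_on s s (vspace M x) UNIV (N y x)"
  shows "linear_map_on sf sf col_space UNIV (apply_full N)"
  unfolding apply_full_def col_space_def
proof (rule linear_map_on_block_apply[OF V.vector_space_axioms])
  show "linear_map_on s s (summands x) UNIV (full_matrix N y x)" if "y \<in> row_ix" "x \<in> col_ix" for x y
    using that assms linear_block1 linear_block2 linear_block4 linear_block5 linear_zero_map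
    by (auto simp: row_ix_def col_ix_def summands_def full_matrix_def block_column_def block_row_def
        zero_block_def Plus_def)
qed

lemma apply_full_rows1:
  assumes t: "1 \<le> t" "Suc t \<le> k"
  shows "apply_full N w (Inl (sup (a t) (a (Suc t)))) =
    struct_map M (sup (a t) (a (Suc t))) (a t) (w (Inl (a t)))
    - struct_map M (sup (a t) (a (Suc t))) (a (Suc t)) (w (Inl (a (Suc t))))"
proof -
  let ?y = "sup (a t) (a (Suc t))"
  have "?y \<in> sc1 k a" using t by (auto simp: sc1_def)
  then have "apply_full N w (Inl ?y) = (\<Sum>x\<in>sc I. block1 M k a ?y x (w (Inl x)))"
    by (simp add: apply_full_def block_apply_def row_ix_def col_ix_def full_matrix_def block_column_def
        block_row_def zero_block_def sum.Plus finite_index_sets InlI)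
  also have "\<dots> = struct_map M ?y (a t) (w (Inl (a t))) + - struct_map M ?y (a (Suc t)) (w (Inl (a (Suc t))))"
    unfolding block1_eq[OF t] using t a_in(1)[of t] a_in(1)[of "Suc t"] a.inj[of t "Suc t"]
    by (intro sum_two_indices finite_index_sets) auto
  finally show ?thesis by simp
qed

lemma apply_full_rows2:
  assumes y: "y \<in> sc (strict_up_set P I)"
  shows "apply_full N w (Inr (Inl y)) = struct_map M y (c y) (w (Inl (c y)))"
proof -
  have "apply_full N w (Inr (Inl y)) = (\<Sum>x\<in>sc I. block2 M c y x (w (Inl x)))"
    using y by (simp add: apply_full_def block_apply_def row_ix_def col_ix_def full_matrix_def
        block_column_def block_row_def zero_block_def sum.Plus finite_index_sets InlI InrI)
  then show ?thesis
    using sc_strict_up[OF y] by (simp add: block2_def finite_index_sets)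
qed

text \<open>Y applied to the last two column blocks: the part of a row in \<open>sk I\<close> that
  does not depend on the corner.\<close>

definition lower :: "(nat \<times> nat + nat \<times> nat + nat \<times> nat \<Rightarrow> 'v) \<Rightarrow> nat \<times> nat \<Rightarrow> 'v" where
  "lower w y = (\<Sum>x\<in>sk (strict_down_set P I). block4 M d y x (w (Inr (Inl x))))
    + (\<Sum>x\<in>sk1 l b. block5 M l b y x (w (Inr (Inr x))))"

lemma apply_full_rows3:
  "y \<in> sk I \<Longrightarrow> apply_full N w (Inr (Inr y)) = (\<Sum>x\<in>sc I. N y x (w (Inl x))) + lower w y"
  by (simp add: apply_full_def block_apply_def row_ix_def col_ix_def full_matrix_def
        block_column_def block_row_def zero_block_def sum.Plus finite_index_sets lower_def InlI InrI)

lemma apply_full_outside: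
  "y \<notin> sc1 k a \<Longrightarrow> apply_full N w (Inl y) = 0"
  "y \<notin> sc (strict_up_set P I) \<Longrightarrow> apply_full N w (Inr (Inl y)) = 0"
  "y \<notin> sk I \<Longrightarrow> apply_full N w (Inr (Inr y)) = 0"
  by (auto simp: apply_full_def block_apply_def row_ix_def)

lemma apply_full_corner:
  "apply_full corner w = apply_full zero_block w
    + single (Inr (Inr (b j))) (struct_map M (b j) (a i) (w (Inl (a i))))"
proof
  fix y :: "nat \<times> nat + nat \<times> nat + nat \<times> nat"
  have *: "(\<Sum>x\<in>sc I. corner z x (w (Inl x))) =
      (if z = b j then struct_map M (b j) (a i) (w (Inl (a i))) else 0)" for z
    using a_in(1)[OF i] by (cases "z = b j") (simp_all add: block3_def finite_index_sets)
  consider y' where "y = Inl y'" | y' where "y = Inr (Inl y')" | y' where "y = Inr (Inr y')"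
    by (metis sumE)
  then show "apply_full corner w y = (apply_full zero_block w
    + single (Inr (Inr (b j))) (struct_map M (b j) (a i) (w (Inl (a i))))) y"
  proof cases
    case 1
    then show ?thesis
      by (cases "y' \<in> sc1 k a") (auto simp: apply_full_outside single_def apply_full_rows1 sc1_def)
  next
    case 2
    then show ?thesis
      by (cases "y' \<in> sc (strict_up_set P I)") (auto simp: apply_full_outside single_def apply_full_rows2)
  next
    case 3
    then show ?thesis
      using b_in(1)[OF j]
      by (cases "y' \<in> sk I") (auto simp: apply_full_outside single_def apply_full_rows3 * zero_block_def)
  qed
qed

lemma col_spaceD:
  assumes "w \<in> col_space"
  shows "x \<in> sc I \<Longrightarrow> w (Inl x) \<in> vspace M x"
    and "x \<in> sk (strict_down_set P I) \<Longrightarrow> w (Inr (Inl x)) \<in> vspace M x"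
    and "x \<in> sk1 l b \<Longrightarrow> w (Inr (Inr x)) \<in> vspace M x"
  using assms by (force simp: col_space_def direct_sum_space_def col_ix_def summands_def)+

section \<open>Pairing the columns of \<open>M4\<close> and \<open>M5\<close> with linear
  forms\<close>

lemma linear_map_on_zero:
  assumes "linear_map_on s t (vspace M x) UNIV h" "x \<in> P" "\<And>y. t 0 y = 0"
  shows "h 0 = 0"
  using assms zero_in_vspace[of x] V.scale_zero_left[of 0] unfolding linear_map_on_def by metis

text \<open>Contracting the rows against linear forms turns a column of \<open>M4\<close>, and
  likewise one of \<open>M5\<close>, into the expression whose vanishing
  \<open>hom_to_extend\<close> requires.\<close>

lemma sum_block4:
  fixes g :: "nat \<times> nat \<Rightarrow> 'v \<Rightarrow> 'k"
  assumes x: "x \<in> sk (strict_down_set P I)" and zero: "\<And>y. y \<in> sk I \<Longrightarrow> g y 0 = 0"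
  shows "(\<Sum>y\<in>sk I. g y (block4 M d y x v)) = g (d x) (struct_map M (d x) x v)"
proof -
  have "(\<Sum>y\<in>sk I. g y (block4 M d y x v)) = (\<Sum>y\<in>sk I. if y = d x then g y (struct_map M y x v) else 0)"
    using zero by (intro sum.cong) (auto simp: block4_def)
  then show ?thesis using sk_strict_down[OF x] by (simp add: finite_index_sets)
qed

lemma sum_block5:
  fixes g :: "nat \<times> nat \<Rightarrow> 'v \<Rightarrow> 'k"
  assumes t: "1 \<le> t" "Suc t \<le> l" and x: "x = inf (b t) (b (Suc t))" and v: "v \<in> vspace M x"
    and g: "\<And>y. y \<in> sk I \<Longrightarrow> linear_map_on s (*) (vspace M y) UNIV (g y)"
  shows "(\<Sum>y\<in>sk I. g y (block5 M l b y x v)) =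
    g (b t) (struct_map M (b t) x v) - g (b (Suc t)) (struct_map M (b (Suc t)) x v)"
proof -
  have zero: "g y 0 = 0" if "y \<in> sk I" for y
    using linear_map_on_zero[OF g[OF that] index_in_P(2)[OF that]] by simp
  have xP: "x \<in> P" using b_inf_in[OF t] x by simp
  have b': "b (Suc t) \<in> sk I" "x \<le> b (Suc t)" using b_in(1)[of "Suc t"] t x by auto
  have "g (b (Suc t)) (s (- 1) (struct_map M (b (Suc t)) x v)) = - 1 * g (b (Suc t)) (struct_map M (b (Suc t)) x v)"
    using g[OF b'(1)] struct_map_in[OF xP index_in_P(2)[OF b'(1)] b'(2) v]
    by (simp only: linear_map_on_def)
  then have neg: "g (b (Suc t)) (- struct_map M (b (Suc t)) x v) = - g (b (Suc t)) (struct_map M (b (Suc t)) x v)"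
    by simp
  have "(\<Sum>y\<in>sk I. g y (block5 M l b y x v)) =
      (\<Sum>y\<in>sk I. if y = b t then g y (struct_map M y x v)
        else if y = b (Suc t) then g y (- struct_map M y x v) else 0)"
    unfolding x block5_eq[OF t] using zero by (intro sum.cong) auto
  also have "\<dots> = g (b t) (struct_map M (b t) x v) + g (b (Suc t)) (- struct_map M (b (Suc t)) x v)"
    using t b_in(1)[of t] b_in(1)[of "Suc t"] b.inj[of t "Suc t"]
    by (intro sum_two_indices finite_index_sets) auto
  finally show ?thesis using neg by simp
qed

lemma block4_in:
  "x \<in> sk (strict_down_set P I) \<Longrightarrow> v \<in> vspace M x \<Longrightarrow> y \<in> sk I \<Longrightarrow> block4 M d y x v \<in> vspace M y"
  using sk_strict_down[of x] index_in_P(2)[of y] by (auto simp: block4_def struct_map_in zero_in_vspace)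

lemma block5_in:
  assumes x: "x \<in> sk1 l b" and v: "v \<in> vspace M x" and y: "y \<in> sk I"
  shows "block5 M l b y x v \<in> vspace M y"
proof -
  obtain t where t: "1 \<le> t" "Suc t \<le> l" and xt: "x = inf (b t) (b (Suc t))"
    using x by (auto simp: sk1_def)
  have "struct_map M y x v \<in> vspace M y" if "y = b t \<or> y = b (Suc t)"
    using that xt index_in_P(2)[OF y] index_in_P(4)[OF x] v by (intro struct_map_in) auto
  then show ?thesis
    using index_in_P(2)[OF y] block5_eq[OF t, of y v] xt
    by (cases "y = b t"; cases "y = b (Suc t)")
       (simp_all add: zero_in_vspace V.subspace_neg subspace_vspace)
qed

lemma lower_in: "w \<in> col_space \<Longrightarrow> y \<in> sk I \<Longrightarrow> lower w y \<in> vspace M y"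
  unfolding lower_def
  by (intro V.subspace_add V.subspace_sum subspace_vspace index_in_P(2) block4_in block5_in col_spaceD)

text \<open>Morphisms to V_I annihilate the image of Y. For a column of \<open>M4\<close>,
  naturality moves g to a point outside I, where it vanishes; for one of \<open>M5\<close>, both
  terms equal g at the meet and cancel.\<close>

lemma hom_to_lower:
  assumes g: "hom_to s P I M g" and w: "w \<in> col_space"
  shows "(\<Sum>y\<in>sk I. g y (lower w y)) = 0"
proof -
  let ?D = "sk (strict_down_set P I)" and ?S = "sk1 l b"
  have glin: "linear_map_on s (*) (vspace M y) UNIV (g y)" if "y \<in> sk I" for y
    using g index_in_P(2)[OF that] by (simp add: hom_to_def)
  have "(\<Sum>y\<in>sk I. g y (lower w y)) =
      (\<Sum>y\<in>sk I. (\<Sum>x\<in>?D. g y (block4 M d y x (w (Inr (Inl x)))))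
        + (\<Sum>x\<in>?S. g y (block5 M l b y x (w (Inr (Inr x))))))"
  proof (rule sum.cong[OF refl])
    fix y assume y: "y \<in> sk I"
    have in4: "block4 M d y x (w (Inr (Inl x))) \<in> vspace M y" if "x \<in> ?D" for x
      using block4_in col_spaceD(2)[OF w] that y by blast
    have in5: "block5 M l b y x (w (Inr (Inr x))) \<in> vspace M y" if "x \<in> ?S" for x
      using block5_in col_spaceD(3)[OF w] that y by blast
    have yP: "y \<in> P" using index_in_P(2)[OF y] .
    show "g y (lower w y) = (\<Sum>x\<in>?D. g y (block4 M d y x (w (Inr (Inl x)))))
        + (\<Sum>x\<in>?S. g y (block5 M l b y x (w (Inr (Inr x)))))"
      unfolding lower_def
      by (subst hom_to_add[OF g yP])
         (auto intro!: V.subspace_sum subspace_vspace yP in4 in5 hom_to_sum[OF g yP]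
            arg_cong2[of _ _ _ _ "(+)"] finite_index_sets)
  qed
  also have "\<dots> = (\<Sum>x\<in>?D. \<Sum>y\<in>sk I. g y (block4 M d y x (w (Inr (Inl x)))))
      + (\<Sum>x\<in>?S. \<Sum>y\<in>sk I. g y (block5 M l b y x (w (Inr (Inr x)))))"
    by (simp add: sum.distrib sum.swap[of _ "sk I"])
  also have "(\<Sum>x\<in>?D. \<Sum>y\<in>sk I. g y (block4 M d y x (w (Inr (Inl x))))) = 0"
  proof (rule sum.neutral, rule ballI)
    fix x assume x: "x \<in> ?D"
    let ?v = "w (Inr (Inl x))"
    have v: "?v \<in> vspace M x" using col_spaceD(2)[OF w x] .
    have dx: "d x \<in> P \<inter> I" "x \<in> P" "x \<notin> I" "x \<le> d x"
      using sk_strict_down[OF x] sk_sub I_sub by blast+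
    have "(\<Sum>y\<in>sk I. g y (block4 M d y x ?v)) = g (d x) (struct_map M (d x) x ?v)"
      using hom_to_zero[OF g] index_in_P(2) by (intro sum_block4[OF x]) blast
    also have "\<dots> = 0" using g dx v by (simp add: hom_to_def)
    finally show "(\<Sum>y\<in>sk I. g y (block4 M d y x ?v)) = 0" .
  qed
  also have "(\<Sum>x\<in>?S. \<Sum>y\<in>sk I. g y (block5 M l b y x (w (Inr (Inr x))))) = 0"
  proof (rule sum.neutral, rule ballI)
    fix x assume x: "x \<in> ?S"
    let ?v = "w (Inr (Inr x))"
    obtain t where t: "1 \<le> t" "Suc t \<le> l" and xt: "x = inf (b t) (b (Suc t))"
      using x by (auto simp: sk1_def)
    have v: "?v \<in> vspace M x" using col_spaceD(3)[OF w x] .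
    have "b t \<in> P \<inter> I" "b (Suc t) \<in> P \<inter> I" "x \<le> b t" "x \<le> b (Suc t)" "x \<in> P"
      using b_in[of t] b_in[of "Suc t"] t xt index_in_P(4)[OF x] by auto
    moreover have "(\<Sum>y\<in>sk I. g y (block5 M l b y x ?v)) =
        g (b t) (struct_map M (b t) x ?v) - g (b (Suc t)) (struct_map M (b (Suc t)) x ?v)"
      using glin by (rule sum_block5[OF t xt v])
    ultimately show "(\<Sum>y\<in>sk I. g y (block5 M l b y x ?v)) = 0"
      using g v by (simp add: hom_to_def)
  qed
  finally show ?thesis by simp
qed

section \<open>Image vectors with vanishing upper block rows\<close>

definition upper :: "(nat \<times> nat + nat \<times> nat + nat \<times> nat \<Rightarrow> 'v) \<Rightarrow> (nat \<times> nat + nat \<times> nat + nat \<times> nat \<Rightarrow> 'v)" where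
  "upper r = case_sum (\<lambda>y. r (Inl y)) (case_sum (\<lambda>y. r (Inr (Inl y))) (\<lambda>_. 0))"

lemma upper_simps [simp]:
  "upper r (Inl y) = r (Inl y)" "upper r (Inr (Inl y)) = r (Inr (Inl y))" "upper r (Inr (Inr y)) = 0"
  by (simp_all add: upper_def)

lemma row_ext:
  assumes "\<And>y. r (Inl y) = r' (Inl y)" "\<And>y. r (Inr (Inl y)) = r' (Inr (Inl y))"
    "\<And>y. r (Inr (Inr y)) = r' (Inr (Inr y))"
  shows "r = r'"
  using assms by (metis ext sumE)

lemma linear_upper: "Vector_Spaces.linear sf sf upper"
  unfolding Vector_Spaces.linear_iff
  using vector_space_pointwise[OF V.vector_space_axioms]
  by (auto intro!: row_ext)

lemma upper_eq_0_iff: "upper r = 0 \<longleftrightarrow> (\<forall>y. r (Inl y) = 0) \<and> (\<forall>y. r (Inr (Inl y)) = 0)"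
  by (auto intro!: row_ext dest: fun_cong[of _ _ "Inl _"] fun_cong[of _ _ "Inr (Inl _)"])

text \<open>The corner reaches only rows in \<open>sk I\<close>. Rank-nullity for
  \<open>upper\<close> on the two images therefore turns the difference of ranks into a difference
  of dimensions of kernels.\<close>

lemma upper_corner: "upper (apply_full corner w) = upper (apply_full zero_block w)"
  by (rule row_ext) (simp_all add: apply_full_corner single_def)

text \<open>For the zero corner this is the image of Y; for the corner \<open>M3\<close> it also
  contains what \<open>M3\<close> produces from ker X.\<close>

definition kernel_part where
  "kernel_part N = {r \<in> apply_full N ` col_space. upper r = 0}"

lemma linear_zero_block: "linear_map_on s s (vspace M x) UNIV (zero_block y x)"
  by (simp add: linear_map_on_def zero_block_def)

lemma image_space:
  assumes "\<And>x y. linear_map_on s s (vspace M x) UNIV (N y x)"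
  shows "module.subspace sf (apply_full N ` col_space)"
    and "finitely_spanned sf (apply_full N ` col_space)"
proof -
  have ix: "x \<in> P \<Longrightarrow> V.subspace (vspace M x) \<and> finitely_spanned s (vspace M x)" for x
    by (simp add: subspace_vspace finitely_spanned_vspace)
  have sp: "V.subspace (summands x) \<and> finitely_spanned s (summands x)" if "x \<in> col_ix" for x
    using that ix index_in_P by (auto simp: col_ix_def summands_def)
  have "finite col_ix" by (simp add: col_ix_def finite_index_sets)
  then have cs: "module.subspace sf col_space" "finitely_spanned sf col_space"
    unfolding col_space_def using sp V.vector_space_axioms
    by (blast intro: direct_sum_space_subspace direct_sum_space_finitely_spanned)+
  note vs = vector_space_pointwise[OF V.vector_space_axioms]
  show "module.subspace sf (apply_full N ` col_space)" "finitely_spanned sf (apply_full N ` col_space)"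
    using linear_map_on_image[OF vs vs linear_apply_full[where N = N, OF assms] cs] by blast+
qed

lemma kernel_part_space:
  assumes "\<And>x y. linear_map_on s s (vspace M x) UNIV (N y x)"
  shows "module.subspace sf (kernel_part N)" and "finitely_spanned sf (kernel_part N)"
proof -
  interpret F: vector_space sf by (rule vector_space_pointwise[OF V.vector_space_axioms])
  interpret FF: vector_space_pair sf sf ..
  have "kernel_part N = apply_full N ` col_space \<inter> {r. upper r = 0}"
    by (auto simp: kernel_part_def)
  then show "F.subspace (kernel_part N)"
    using F.subspace_inter[OF image_space(1)[where N = N, OF assms] FF.linear_subspace_kernel[OF linear_upper]]
    by simp
  show "finitely_spanned sf (kernel_part N)"
    by (rule finitely_spanned_subset[OF F.vector_space_axioms image_space(2)[where N = N, OF assms]])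
       (auto simp: kernel_part_def)
qed

lemma no_source_in_kernel:
  assumes w: "w \<in> col_space" and "\<And>x. w (Inl x) = 0"
  shows "apply_full N w (Inl y) = 0" "apply_full N w (Inr (Inl y)) = 0"
proof -
  show "apply_full N w (Inl y) = 0"
  proof (cases "y \<in> sc1 k a")
    case True
    then obtain t where t: "1 \<le> t" "Suc t \<le> k" and y: "y = sup (a t) (a (Suc t))"
      by (auto simp: sc1_def)
    then show ?thesis
      using a_in(3)[of t] a_in(3)[of "Suc t"] a_sup_in[OF t]
      by (simp add: apply_full_rows1 assms(2) struct_map_zero)
  qed (simp add: apply_full_outside)
  show "apply_full N w (Inr (Inl y)) = 0"
    using sc_strict_up[of y] index_in_P(1)[of "c y"]
    by (cases "y \<in> sc (strict_up_set P I)")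
       (auto simp: apply_full_rows2 apply_full_outside assms(2) struct_map_zero)
qed

lemma apply_zero_block_row3: "y \<in> sk I \<Longrightarrow> apply_full zero_block w (Inr (Inr y)) = lower w y"
  by (simp add: apply_full_rows3 zero_block_def)

lemma apply_zero_block_no_source:
  assumes w: "w \<in> col_space" and 0: "\<And>x. w (Inl x) = 0"
  shows "apply_full zero_block w = (\<Sum>y\<in>sk I. single (Inr (Inr y)) (lower w y))"
proof (rule row_ext)
  show "apply_full zero_block w (Inr (Inr y)) = (\<Sum>y\<in>sk I. single (Inr (Inr y)) (lower w y)) (Inr (Inr y))" for y
    by (cases "y \<in> sk I")
       (simp_all add: sum_apply single_def apply_zero_block_row3 apply_full_outside finite_index_sets)
qed (simp_all add: no_source_in_kernel[OF w 0] sum_apply single_def)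

lemma apply_zero_block_in_kernel_part:
  assumes "w \<in> col_space" "\<And>x. w (Inl x) = 0"
  shows "apply_full zero_block w \<in> kernel_part zero_block"
  using assms no_source_in_kernel[OF assms] by (auto simp: kernel_part_def upper_eq_0_iff)

text \<open>With zero corner the source part of w does not reach the rows in \<open>sk I\<close>.
  Erasing it keeps a vector whose upper rows vanish, and without source part the two matrices act
  alike.\<close>

lemma kernel_part_zero_block_subset: "kernel_part zero_block \<subseteq> kernel_part corner"
proof
  fix r assume r: "r \<in> kernel_part zero_block"
  then obtain w where w: "w \<in> col_space" "r = apply_full zero_block w" and u: "upper r = 0"
    by (auto simp: kernel_part_def)
  define w' :: "nat \<times> nat + nat \<times> nat + nat \<times> nat \<Rightarrow> 'v" where "w' = case_sum (\<lambda>_. 0) (\<lambda>x. w (Inr x))"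
  have w'_in: "w' \<in> col_space"
    using w(1) index_in_P zero_in_vspace
    by (auto simp: col_space_def direct_sum_space_def col_ix_def summands_def w'_def split: sum.splits)
  have w'_0: "w' (Inl x) = 0" for x by (simp add: w'_def)
  have lower: "lower w' = lower w" by (simp add: lower_def w'_def fun_eq_iff)
  have r0: "r (Inl y) = 0" "r (Inr (Inl y)) = 0" for y
    using u unfolding upper_eq_0_iff by blast+
  have "apply_full zero_block w' = r"
  proof (rule row_ext)
    show "apply_full zero_block w' (Inr (Inr y)) = r (Inr (Inr y))" for y
      using w(2) lower by (cases "y \<in> sk I") (simp_all add: apply_zero_block_row3 apply_full_outside)
  qed (simp_all add: no_source_in_kernel[OF w'_in w'_0] r0)
  moreover have "apply_full corner w' = apply_full zero_block w'"
    using a_in(3)[OF i] b_in(3)[OF j] le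
    by (auto simp: apply_full_corner w'_0 struct_map_zero single_def fun_eq_iff)
  ultimately have "r = apply_full corner w'" by simp
  then show "r \<in> kernel_part corner"
    using w'_in u by (auto simp: kernel_part_def)
qed

text \<open>Vanishing of the rows of \<open>M1\<close> and \<open>M2\<close> is exactly the set of
  relations in \<open>hom_from_extend\<close>, so a vector of ker X comes from a morphism V_I ->
  M.\<close>

lemma kernel_hom_from:
  assumes w: "w \<in> col_space" and u: "upper (apply_full N w) = 0"
  obtains f where "hom_from P I M f" "\<And>x. x \<in> sc I \<Longrightarrow> f x = w (Inl x)"
proof (rule hom_from_extend[of "\<lambda>x. w (Inl x)"])
  show "w (Inl x) \<in> vspace M x" if "x \<in> sc I" for x using col_spaceD(1)[OF w that] .
  show "struct_map M (sup (a t) (a (Suc t))) (a t) (w (Inl (a t)))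
        = struct_map M (sup (a t) (a (Suc t))) (a (Suc t)) (w (Inl (a (Suc t))))"
    if "1 \<le> t" "Suc t \<le> k" for t
  proof -
    have "apply_full N w (Inl (sup (a t) (a (Suc t)))) = 0"
      using u unfolding upper_eq_0_iff by blast
    then show ?thesis by (simp add: apply_full_rows1[OF that])
  qed
  show "struct_map M x (c x) (w (Inl (c x))) = 0" if "x \<in> sc (strict_up_set P I)" for x
    using u apply_full_rows2[OF that, of N w] unfolding upper_eq_0_iff by metis
qed (rule that)

text \<open>Sends a morphism back to ker X. The padding by 0 is forced by
  \<open>direct_sum_space\<close>, whose families vanish off the index set.\<close>

definition source_vector :: "(nat \<times> nat \<Rightarrow> 'v) \<Rightarrow> nat \<times> nat + nat \<times> nat + nat \<times> nat \<Rightarrow> 'v" where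
  "source_vector f = case_sum (\<lambda>x. if x \<in> sc I then f x else 0) (\<lambda>_. 0)"

text \<open>Naturality cancels the terms at the joins, and f is 0 outside I, so the upper rows
  vanish. The entry of \<open>M3\<close> carries the value at \<open>a i\<close> to the value at
  \<open>b j\<close>.\<close>

lemma hom_from_kernel:
  assumes f: "hom_from P I M f"
  shows "source_vector f \<in> col_space"
    and "apply_full corner (source_vector f) = single (Inr (Inr (b j))) (f (b j))"
proof -
  have f_in: "f x \<in> vspace M x" if "x \<in> P" for x
    using f that by (simp add: hom_from_def)
  have f_map: "struct_map M y x (f x) = f y" if "x \<in> P" "x \<in> I" "y \<in> P" "x \<le> y" for x y
    using f that by (simp add: hom_from_def)
  show "source_vector f \<in> col_space"
    using index_in_P zero_in_vspace f_in
    by (auto simp: col_space_def direct_sum_space_def col_ix_def summands_def source_vector_def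
        split: sum.splits)
  have "apply_full zero_block (source_vector f) = 0"
  proof (rule row_ext)
    fix y
    show "apply_full zero_block (source_vector f) (Inl y) = (0 :: _ \<Rightarrow> 'v) (Inl y)"
    proof (cases "y \<in> sc1 k a")
      case True
      then obtain t where t: "1 \<le> t" "Suc t \<le> k" and y: "y = sup (a t) (a (Suc t))"
        by (auto simp: sc1_def)
      then show ?thesis
        using a_in[of t] a_in[of "Suc t"] a_sup_in[OF t]
        by (simp add: apply_full_rows1 source_vector_def f_map)
    qed (simp add: apply_full_outside)
    show "apply_full zero_block (source_vector f) (Inr (Inl y)) = (0 :: _ \<Rightarrow> 'v) (Inr (Inl y))"
    proof (cases "y \<in> sc (strict_up_set P I)")
      case True
      have "f y = 0" using f sc_strict_up[OF True] by (simp add: hom_from_def)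
      then show ?thesis
        using sc_strict_up[OF True] index_in_P(1)[of "c y"] sc_sub[of "c y"]
        by (simp add: apply_full_rows2[OF True] source_vector_def f_map)
    qed (simp add: apply_full_outside)
    have "lower (source_vector f) y = 0"
      using linear_map_on_zero[OF linear_block4 index_in_P(3)] linear_map_on_zero[OF linear_block5 index_in_P(4)]
      by (auto simp: lower_def source_vector_def intro!: sum.neutral)
    then show "apply_full zero_block (source_vector f) (Inr (Inr y)) = (0 :: _ \<Rightarrow> 'v) (Inr (Inr y))"
      by (cases "y \<in> sk I") (simp_all add: apply_zero_block_row3 apply_full_outside)
  qed
  then show "apply_full corner (source_vector f) = single (Inr (Inr (b j))) (f (b j))"
    using a_in[OF i] b_in[OF j] le by (simp add: apply_full_corner source_vector_def f_map)
qed

text \<open>Duality between coker Y and Hom(M, V_I). A functional that kills the image of Y but not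
  the given vector restricts to linear forms at the maximal elements; killing the columns of
  \<open>M4\<close> and \<open>M5\<close> means that these forms extend to a morphism g, and then
  \<open>g (b j) u = 1\<close>.\<close>

lemma single_in_kernel_part:
  assumes u: "u \<in> vspace M (b j)" and van: "\<And>g. hom_to s P I M g \<Longrightarrow> g (b j) u = 0"
  shows "single (Inr (Inr (b j))) u \<in> kernel_part zero_block"
proof (rule ccontr)
  assume notin: "single (Inr (Inr (b j))) u \<notin> kernel_part zero_block"
  interpret F: vector_space sf by (rule vector_space_pointwise[OF V.vector_space_axioms])
  interpret K: vector_space "(*) :: 'k \<Rightarrow> 'k \<Rightarrow> 'k"
    by unfold_locales (auto simp: algebra_simps)
  interpret FK: vector_space_pair sf "(*) :: 'k \<Rightarrow> 'k \<Rightarrow> 'k" ..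
  obtain \<phi> :: "(nat \<times> nat + nat \<times> nat + nat \<times> nat \<Rightarrow> 'v) \<Rightarrow> 'k"
    where \<phi>: "Vector_Spaces.linear sf (*) \<phi>" "\<And>r. r \<in> kernel_part zero_block \<Longrightarrow> \<phi> r = 0"
      "\<phi> (single (Inr (Inr (b j))) u) = 1"
    using FK.linear_functional_separating[OF kernel_part_space(1)[OF linear_zero_block] notin, of 1]
    by auto
  define h where "h = (\<lambda>y v. \<phi> (single (Inr (Inr y)) v))"
  have h_add: "h y (v + v') = h y v + h y v'" and h_scale: "h y (s t v) = t * h y v" for y v v' t
  proof -
    have S: "single (Inr (Inr y)) (v + v') = single (Inr (Inr y)) v + single (Inr (Inr y)) v'"
      "single (Inr (Inr y)) (s t v) = sf t (single (Inr (Inr y)) v)"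
      by (auto simp: single_def fun_eq_iff)
    show "h y (v + v') = h y v + h y v'"
      unfolding h_def S(1) by (rule FK.linear_add[OF \<phi>(1)])
    show "h y (s t v) = t * h y v"
      unfolding h_def S(2) by (rule FK.linear_scale[OF \<phi>(1)])
  qed
  have h_lin: "linear_map_on s (*) (vspace M y) UNIV (h y)" for y
    by (simp add: linear_map_on_def h_add h_scale)
  have h_0: "h y 0 = 0" for y using h_scale[of y 0 0] by simp
  have h_lower: "(\<Sum>y\<in>sk I. h y (lower w y)) = 0" if w: "w \<in> col_space" "\<And>x. w (Inl x) = 0" for w
    using \<phi>(2)[OF apply_zero_block_in_kernel_part[OF w]]
    by (simp add: apply_zero_block_no_source[OF w] FK.linear_sum[OF \<phi>(1)] h_def)
  obtain g where g: "hom_to s P I M g" "\<And>y v. y \<in> sk I \<Longrightarrow> v \<in> vspace M y \<Longrightarrow> g y v = h y v"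
  proof (rule hom_to_extend[of h])
    show "h (b t) (struct_map M (b t) (inf (b t) (b (Suc t))) v)
        = h (b (Suc t)) (struct_map M (b (Suc t)) (inf (b t) (b (Suc t))) v)"
      if t: "1 \<le> t" "Suc t \<le> l" and v: "v \<in> vspace M (inf (b t) (b (Suc t)))" for t v
    proof -
      let ?x = "inf (b t) (b (Suc t))"
      \<comment> \<open>A test vector in a single column of \<open>M5\<close>; on it
        \<open>h_lower\<close> becomes the relation at this meet.\<close>
      let ?w = "single (Inr (Inr ?x)) v :: nat \<times> nat + nat \<times> nat + nat \<times> nat \<Rightarrow> 'v"
      have x: "?x \<in> sk1 l b" using t by (auto simp: sk1_def)
      have w: "?w \<in> col_space" "?w (Inl z) = 0" for z
        using x v index_in_P zero_in_vspace
        by (auto simp: col_space_def direct_sum_space_def col_ix_def summands_def single_def split: sum.splits)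
      have "lower ?w y = block5 M l b y ?x v" for y
      proof -
        have "(\<Sum>x\<in>sk1 l b. block5 M l b y x (?w (Inr (Inr x)))) =
            (\<Sum>x\<in>sk1 l b. if x = ?x then block5 M l b y x v else 0)"
          using linear_map_on_zero[OF linear_block5 index_in_P(4)]
          by (intro sum.cong) (auto simp: single_def)
        moreover have "(\<Sum>x\<in>sk (strict_down_set P I). block4 M d y x (?w (Inr (Inl x)))) = 0"
          using linear_map_on_zero[OF linear_block4 index_in_P(3)]
          by (intro sum.neutral) (auto simp: single_def)
        ultimately show ?thesis using x by (simp add: lower_def finite_index_sets)
      qed
      then show ?thesis
        using h_lower[OF w] sum_block5[OF t refl v h_lin] by simp
    qed
    show "h (d x) (struct_map M (d x) x v) = 0"
      if x: "x \<in> sk (strict_down_set P I)" and v: "v \<in> vspace M x" for x v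
    proof -
      let ?w = "single (Inr (Inl x)) v :: nat \<times> nat + nat \<times> nat + nat \<times> nat \<Rightarrow> 'v"
      have w: "?w \<in> col_space" "?w (Inl z) = 0" for z
        using x v index_in_P zero_in_vspace
        by (auto simp: col_space_def direct_sum_space_def col_ix_def summands_def single_def split: sum.splits)
      have "lower ?w y = block4 M d y x v" for y
      proof -
        have "(\<Sum>z\<in>sk (strict_down_set P I). block4 M d y z (?w (Inr (Inl z)))) =
            (\<Sum>z\<in>sk (strict_down_set P I). if z = x then block4 M d y z v else 0)"
          using linear_map_on_zero[OF linear_block4 index_in_P(3)]
          by (intro sum.cong) (auto simp: single_def)
        moreover have "(\<Sum>z\<in>sk1 l b. block5 M l b y z (?w (Inr (Inr z)))) = 0"
          using linear_map_on_zero[OF linear_block5 index_in_P(4)]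
          by (intro sum.neutral) (auto simp: single_def)
        ultimately show ?thesis using x by (simp add: lower_def finite_index_sets)
      qed
      then show ?thesis
        using h_lower[OF w] sum_block4[OF x, of h v] h_0 by simp
    qed
  qed (use h_lin in blast)+
  have "g (b j) u = 1"
    using g(2)[OF b_in(1)[OF j] u] \<phi>(3) by (simp add: h_def)
  then show False using van[OF g(1)] by simp
qed

text \<open>Modulo the image of Y, an element of the larger kernel is the value at
  \<open>b j\<close> of a morphism from V_I, and such a value expands in the generators
  \<open>f q (b j)\<close> with q in T. Pairing with the \<open>g q\<close> shows these generators
  independent modulo that image, so the kernels differ by \<open>card T\<close> in
  dimension.\<close>

lemma rank_formula:
  assumes ds: "is_direct_sum s P M r U"
    and ind: "\<And>q. q < r \<Longrightarrow> indecomposable s P (M\<lparr>vspace := U q\<rparr>)"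
    and con: "poset_connected I"
  shows "vector_space.dim sf (apply_full corner ` col_space) =
    vector_space.dim sf (apply_full zero_block ` col_space)
    + card {q. q < r \<and> pmodule_iso s (*) P (M\<lparr>vspace := U q\<rparr>) (interval_module I)}"
proof -
  interpret F: vector_space sf by (rule vector_space_pointwise[OF V.vector_space_axioms])
  interpret FF: vector_space_pair sf sf ..
  interpret D: direct_sum_decomposition s P M r U by unfold_locales (rule ds)
  define T where "T = {q. q < r \<and> pmodule_iso s (*) P (M\<lparr>vspace := U q\<rparr>) (interval_module I)}"
  obtain f g where
    f: "\<And>q. q \<in> T \<Longrightarrow> hom_from P I M (f q)" and g: "\<And>q. q \<in> T \<Longrightarrow> hom_to s P I M (g q)" and
    dual: "\<And>p q x. p \<in> T \<Longrightarrow> q \<in> T \<Longrightarrow> x \<in> I \<Longrightarrow> g p x (f q x) = (if p = q then 1 else 0)" and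
    expand: "\<And>f' g' x. hom_from P I M f' \<Longrightarrow> hom_to s P I M g' \<Longrightarrow> x \<in> I \<Longrightarrow>
       g' x (f' x) = (\<Sum>q\<in>T. g q x (f' x) * g' x (f q x))"
    using D.interval_summands_dual_system[OF ind I_sub con] unfolding T_def by blast
  have finT: "finite T" by (simp add: T_def)
  note bj = b_in[OF j]
  let ?KA = "kernel_part corner" and ?KB = "kernel_part zero_block"
  let ?S = "single (Inr (Inr (b j))) :: 'v \<Rightarrow> nat \<times> nat + nat \<times> nat + nat \<times> nat \<Rightarrow> 'v"
  let ?e = "\<lambda>q. ?S (f q (b j))"
  note KB = kernel_part_space[where N = zero_block, OF linear_zero_block]
    and KA = kernel_part_space[where N = corner, OF linear_corner]
  have fb_in: "f' (b j) \<in> vspace M (b j)" if "hom_from P I M f'" for f'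
    using that bj by (simp add: hom_from_def)
  have S_add: "?S (v + v') = ?S v + ?S v'" and S_scale: "?S (s t v) = sf t (?S v)" for v v' t
    by (auto simp: single_def fun_eq_iff)
  have S_sum: "?S (\<Sum>q\<in>T. h q) = (\<Sum>q\<in>T. ?S (h q))" for h :: "nat \<Rightarrow> 'v"
    by (auto simp: single_def fun_eq_iff sum_apply)
  have e_in: "?e q \<in> ?KA" if "q \<in> T" for q
    using hom_from_kernel[OF f[OF that]]
    by (auto simp: kernel_part_def upper_eq_0_iff single_def intro!: image_eqI[of _ _ "source_vector (f q)"])
  have "?KA \<subseteq> F.span (?KB \<union> ?e ` T)"
  proof
    fix r assume "r \<in> ?KA"
    then obtain w where w: "w \<in> col_space" "r = apply_full corner w" and u: "upper r = 0"
      by (auto simp: kernel_part_def)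
    obtain f' where f': "hom_from P I M f'" "\<And>x. x \<in> sc I \<Longrightarrow> f' x = w (Inl x)"
      using kernel_hom_from[OF w(1), of corner] u w(2) by auto
    have f'b: "struct_map M (b j) (a i) (w (Inl (a i))) = f' (b j)"
      using f' a_in[OF i] bj le by (auto simp: hom_from_def simp flip: f'(2))
    have r: "r = apply_full zero_block w + ?S (f' (b j))"
      by (simp add: w(2) apply_full_corner f'b)
    have w_KB: "apply_full zero_block w \<in> ?KB"
      using w u upper_corner[of w] by (auto simp: kernel_part_def)
    \<comment> \<open>The expansion of \<open>f' (b j)\<close> along the summands isomorphic to V_I.
      By \<open>expand\<close>, every morphism to V_I takes the same value on v as on
      \<open>f' (b j)\<close>, so the remainder lies in the image of Y.\<close>
    define v where "v = (\<Sum>q\<in>T. s (g q (b j) (f' (b j))) (f q (b j)))"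
    have v_in: "v \<in> vspace M (b j)"
      unfolding v_def using bj f fb_in
      by (intro V.subspace_sum V.subspace_scale subspace_vspace) auto
    have "?S (f' (b j) - v) \<in> ?KB"
    proof (rule single_in_kernel_part)
      show "f' (b j) - v \<in> vspace M (b j)"
        using v_in fb_in[OF f'(1)] bj by (simp add: V.subspace_diff subspace_vspace)
      show "g' (b j) (f' (b j) - v) = 0" if g': "hom_to s P I M g'" for g'
      proof -
        have "g' (b j) v = (\<Sum>q\<in>T. g q (b j) (f' (b j)) * g' (b j) (f q (b j)))"
          unfolding v_def using bj(3) f fb_in finT
          by (subst hom_to_sum[OF g' bj(3)])
             (auto intro!: V.subspace_scale subspace_vspace sum.cong hom_to_scale[OF g'])
        then show ?thesis
          using expand[OF f'(1) g' bj(2)] hom_to_diff[OF g' bj(3) fb_in[OF f'(1)] v_in] by simp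
      qed
    qed
    moreover have "?S v = (\<Sum>q\<in>T. sf (g q (b j) (f' (b j))) (?e q))"
      unfolding v_def S_sum S_scale ..
    then have "?S v \<in> F.span (?KB \<union> ?e ` T)"
      by (simp only:) (intro F.span_sum F.span_scale F.span_base, blast)
    moreover have "r = apply_full zero_block w + ?S (f' (b j) - v) + ?S v"
      using r S_add[of "f' (b j) - v" v] by (simp add: add.assoc)
    ultimately show "r \<in> F.span (?KB \<union> ?e ` T)"
      using w_KB by (metis F.span_add F.span_base UnI1)
  qed
  moreover have "F.span (?KB \<union> ?e ` T) \<subseteq> ?KA"
    using kernel_part_zero_block_subset e_in KA(1) by (intro F.span_minimal) auto
  ultimately have span: "F.span (?KB \<union> ?e ` T) = ?KA" by blast
  let ?W = "{r. \<forall>y\<in>sk I. r (Inr (Inr y)) \<in> vspace M y}"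
  \<comment> \<open>Summing over all maximal elements makes the form vanish on the image of Y, by
    \<open>hom_to_lower\<close>; on the vectors \<open>?e q\<close> only the term at
    \<open>b j\<close> survives.\<close>
  let ?G = "\<lambda>q r. \<Sum>y\<in>sk I. g q y (r (Inr (Inr y)))"
  have "F.dim (F.span (?KB \<union> ?e ` T)) = F.dim ?KB + card T \<and> finitely_spanned sf (F.span (?KB \<union> ?e ` T))"
  proof (rule dim_adjoin_dual_system[OF F.vector_space_axioms finT KB, where G = ?G and W = ?W])
    fix q assume q: "q \<in> T"
    show "?G q (x + y) = ?G q x + ?G q y" if "x \<in> ?W" "y \<in> ?W" for x y
      using that index_in_P(2) by (simp add: hom_to_add[OF g[OF q]] sum.distrib)
    show "?G q (sf t x) = t * ?G q x" if "x \<in> ?W" for x t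
      using that index_in_P(2) by (simp add: hom_to_scale[OF g[OF q]] sum_distrib_left)
    show "?e q \<in> ?W"
      using fb_in[OF f[OF q]] index_in_P(2) zero_in_vspace by (auto simp: single_def)
    show "?G q x = 0" if x: "x \<in> ?KB" for x
    proof -
      obtain w where w: "w \<in> col_space" "x = apply_full zero_block w"
        using x by (auto simp: kernel_part_def)
      then show ?thesis
        using hom_to_lower[OF g[OF q] w(1)] by (simp add: apply_zero_block_row3)
    qed
    fix p assume p: "p \<in> T"
    have "?G p (?e q) = (\<Sum>y\<in>sk I. if y = b j then g p y (f q y) else 0)"
      using hom_to_zero[OF g[OF p]] index_in_P(2) by (intro sum.cong) (auto simp: single_def)
    then show "?G p (?e q) = (if p = q then 1 else 0)"
      using bj dual[OF p q bj(2)] by (simp add: finite_index_sets)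
  next
    show "F.subspace ?W"
      using index_in_P(2) by (intro F.subspaceI)
        (auto simp: zero_in_vspace V.subspace_add V.subspace_scale subspace_vspace)
    show "?KB \<subseteq> ?W"
      using lower_in by (auto simp: kernel_part_def apply_zero_block_row3)
  qed
  then have dimK: "F.dim ?KA = F.dim ?KB + card T" using span by simp
  have "upper ` apply_full corner ` col_space = upper ` apply_full zero_block ` col_space"
    by (simp add: image_image upper_corner)
  then show ?thesis
    using FF.dim_image_plus_dim_kernel[OF linear_upper image_space[where N = corner, OF linear_corner]]
      FF.dim_image_plus_dim_kernel[OF linear_upper image_space[where N = zero_block, OF linear_zero_block]] dimK
    by (simp add: kernel_part_def T_def)
qed

end

theorem mainTheorem2:
  fixes s :: "'k::field \<Rightarrow> 'v::ab_group_add \<Rightarrow> 'v"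
    and m n k l i j :: nat
    and P I :: "(nat \<times> nat) set"
    and M :: "(nat \<times> nat, 'v) pmodule"
    and a b :: "nat \<Rightarrow> nat \<times> nat"
    and c d :: "nat \<times> nat \<Rightarrow> nat \<times> nat"
  assumes "m \<ge> 2" and "n \<ge> 2"
    and "P = grid m n"
    and "is_pmodule s P M"
    and "poset_interval P I"
    and "sc I = a ` {1..k}" and "strict_mono_on {1..k} (\<lambda>q. snd (a q))"
    and "sk I = b ` {1..l}" and "strict_mono_on {1..l} (\<lambda>q. snd (b q))"
    and "up_choice P I c" and "down_choice P I d"
    and "i \<in> {1..k}" and "j \<in> {1..l}" and "a i \<le> b j"
  defines "row_ix \<equiv> sc1 k a <+> sc (strict_up_set P I) <+> sk I"
    and "col_ix \<equiv> sc I <+> sk (strict_down_set P I) <+> sk1 l b"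
    and "summands \<equiv> case_sum (vspace M) (case_sum (vspace M) (vspace M))"
    and "M1 \<equiv> block1 M k a"
    and "M2 \<equiv> block2 M c"
    and "M3 \<equiv> block3 M (b j) (a i)"
    and "M4 \<equiv> block4 M d"
    and "M5 \<equiv> block5 M l b"
  shows "int (multiplicity_in s (*) P M (interval_module I)) =
      int (block_rank s row_ix col_ix summands
        (block_column
          (block_row M1 zero_block zero_block)
          (block_row M2 zero_block zero_block)
          (block_row M3 M4 M5)))
    - int (block_rank s row_ix col_ix summands
        (block_column
          (block_row M1 zero_block zero_block)
          (block_row M2 zero_block zero_block)
          (block_row zero_block M4 M5)))"
proof -
  interpret G: grid_interval_pair s P M m n k l I a b c d i j
    by unfold_locales (use assms(3-14) in \<open>auto simp: poset_interval_def\<close>)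
  let ?A = "G.apply_full G.corner ` G.col_space" and ?B = "G.apply_full zero_block ` G.col_space"
  \<comment> \<open>Truncated subtraction on naturals; \<open>count\<close> shows that nothing is
    cut off.\<close>
  define D where "D = vector_space.dim G.sf ?A - vector_space.dim G.sf ?B"
  have con: "poset_connected I" using assms(5) by (simp add: poset_interval_def)
  have count: "vector_space.dim G.sf ?A = vector_space.dim G.sf ?B + card {q. q < r \<and>
        pmodule_iso s (*) P (M\<lparr>vspace := U q\<rparr>) (interval_module I)}"
    if "is_direct_sum s P M r U" "\<forall>q<r. indecomposable s P (M\<lparr>vspace := U q\<rparr>)" for r U
    using G.rank_formula[OF that(1) _ con] that(2) by blast
  obtain r U where rU: "is_direct_sum s P M r U" "\<forall>q<r. indecomposable s P (M\<lparr>vspace := U q\<rparr>)"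
    using exists_indecomposable_decomposition[OF G.finite_P assms(4)] by blast
  \<comment> \<open>Since \<open>count\<close> applies to every decomposition into indecomposables,
    D is the only possible value of the description, and the decomposition found above attains
    it.\<close>
  have "multiplicity_in s (*) P M (interval_module I) = D"
    unfolding multiplicity_in_def
  proof (rule the_equality)
    show "\<exists>r U. is_direct_sum s P M r U \<and> (\<forall>i<r. indecomposable s P (M\<lparr>vspace := U i\<rparr>)) \<and>
        D = card {i. i < r \<and> pmodule_iso s (*) P (M\<lparr>vspace := U i\<rparr>) (interval_module I)}"
      using rU count[OF rU] by (intro exI[of _ r] exI[of _ U]) (simp add: D_def)
    fix e
    assume "\<exists>r U. is_direct_sum s P M r U \<and> (\<forall>i<r. indecomposable s P (M\<lparr>vspace := U i\<rparr>)) \<and>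
        e = card {i. i < r \<and> pmodule_iso s (*) P (M\<lparr>vspace := U i\<rparr>) (interval_module I)}"
    then show "e = D" using count by (auto simp: D_def)
  qed
  moreover have "vector_space.dim G.sf ?B \<le> vector_space.dim G.sf ?A"
    using count[OF rU] by simp
  ultimately have "int (multiplicity_in s (*) P M (interval_module I)) =
      int (vector_space.dim G.sf ?A) - int (vector_space.dim G.sf ?B)"
    by (simp add: D_def)
  then show ?thesis
    unfolding block_rank_def G.apply_full_def[abs_def] G.col_space_def G.full_matrix_def
      G.row_ix_def G.col_ix_def G.summands_def
      row_ix_def col_ix_def summands_def M1_def M2_def M3_def M4_def M5_def .
qed

end
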